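(* Each boundedly-finite shift-homogeneous metric space $X$ is coarsely isomorphic to the product $X_{s(X)}\times \mathbb Z_{\phi_X}$.
   Context: Metric spaces are nonempty; subsets carry the restricted metric. Here $\omega=\{0,1,2,\dots\}$ and $\Pi$ is the set of prime numbers. A map $f:X\to Y$ between metric spaces is coarse if for each finite $\delta\ge 0$ the oscillation $\omega_f(\delta)=\sup\{d_Y(f(x),f(x')):x,x'\in X,\ d_X(x,x')\le\delta\}$ is finite. It is a coarse isomorphism if it is bijective and both $f$ and $f^{-1}$ are coarse. Two spaces are coarsely isomorphic if there is a coarse isomorphism between them. Products carry the metric $\max\{d_X(x,x'),d_Y(y,y')\}$. A metric space is boundedly-finite if each of its bounded subsets is finite, and proper if each closed bounded subset is compact. For a real $\varepsilon\ge0$, a subset $C\subset X$ is $\varepsilon$-connected if any two points $x,y\in C$ can be linked by points $x=x_0,x_1,\dots,x_n=y$ of $C$ with $d_X(x_{i-1},x_i)\le\varepsilon$ for all $1\le i\le n$. The $\varepsilon$-connected component $X_\varepsilon(x)$ of $x\in X$ is the maximal $\varepsilon$-connected subset of $X$ containing $x$; also $X_\infty(x)=X$. A metric space (or subset) is large scale connected if it is $\varepsilon$-connected for some $\varepsilon<\infty$. A metric space $X$ is shift-homogeneous if for any $x,y\in X$ there is a bijective isometry $f:X\to X$ such that $f(x)=y$ and $\sup_{c\in C}d_X(f(c),c)<\infty$ for every large scale connected subset $C\subset X$. The factorizing step of $X$ is $s(X)=\inf\big(\{\infty\}\cup\{\varepsilon\in[0,\infty):$ for all $\delta\in[\varepsilon,\infty)$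 and all $x\in X$ the set $\{X_\varepsilon(y):y\in X_\delta(x)\}$ is finite$\}\big)$. For a homogeneous $X$ and $\delta\in[0,\infty]$, $X_\delta$ denotes any $\delta$-connected component of $X$ (all are pairwise isometric); $X_{s(X)}$ is called the factorizing component. The factorizing function $\phi_X:\Pi\to\omega\cup\{\infty\}$ of a boundedly-finite homogeneous metric space $X$ is $\phi_X(p)=\sup\{k\in\omega: p^k \text{ divides the cardinality of } \{X_{s(X)}(x):x\in X_\delta\} \text{ for some finite }\delta\}$. For $\phi:\Pi\to\omega\cup\{\infty\}$, $\mathbb Z_\phi=\bigoplus_{p\in\Pi}\mathbb Z_p^{\phi(p)}$ is the direct sum of cyclic groups $\mathbb Z_p=\mathbb Z/p\mathbb Z$, where $\mathbb Z_p^\infty$ means the direct sum of countably infinitely many copies of $\mathbb Z_p$. The countable group $\mathbb Z_\phi$ is endowed with a proper left-invariant metric (such a metric exists and is unique up to coarse isomorphism given by the identity map). *)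

theory Defs
  imports "HOL-Analysis.Analysis" "HOL-Algebra.Product_Groups" "HOL-Algebra.Elementary_Groups"
    "HOL-Computational_Algebra.Primes" "HOL-Library.Extended_Nat"
begin

section \<open>Coarse maps\<close>

definition oscillation :: "'a metric \<Rightarrow> 'b metric \<Rightarrow> ('a \<Rightarrow> 'b) \<Rightarrow> real \<Rightarrow> ereal" where
  "oscillation X Y f \<delta> =
     Sup {ereal (mdist Y (f x) (f x')) | x x'. x \<in> mspace X \<and> x' \<in> mspace X \<and> mdist X x x' \<le> \<delta>}"

definition coarse_map :: "'a metric \<Rightarrow> 'b metric \<Rightarrow> ('a \<Rightarrow> 'b) \<Rightarrow> bool" where
  "coarse_map X Y f \<longleftrightarrow>
     f \<in> mspace X \<rightarrow> mspace Y \<and> (\<forall>\<delta>\<ge>0. oscillation X Y f \<delta> < \<infinity>)"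

definition coarse_isomorphism :: "'a metric \<Rightarrow> 'b metric \<Rightarrow> ('a \<Rightarrow> 'b) \<Rightarrow> bool" where
  "coarse_isomorphism X Y f \<longleftrightarrow>
     bij_betw f (mspace X) (mspace Y) \<and>
     coarse_map X Y f \<and> coarse_map Y X (inv_into (mspace X) f)"

definition coarsely_isomorphic :: "'a metric \<Rightarrow> 'b metric \<Rightarrow> bool" where
  "coarsely_isomorphic X Y \<longleftrightarrow> (\<exists>f. coarse_isomorphism X Y f)"

text \<open>The library's \<^const>\<open>prod_metric\<close> is the Euclidean product; here products carry the
  maximum metric.\<close>

definition max_prod_metric :: "'a metric \<Rightarrow> 'b metric \<Rightarrow> ('a \<times> 'b) metric" where
  "max_prod_metric X Y =
     metric (mspace X \<times> mspace Y,
             \<lambda>(x, y) (x', y'). max (mdist X x x') (mdist Y y y'))"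

lemma Metric_space_max_prod:
  "Metric_space (mspace X \<times> mspace Y)
     (\<lambda>(x, y) (x', y'). max (mdist X x x') (mdist Y y y'))"
proof (rule Metric_space.intro, goal_cases)
  case (1 a b)
  show ?case by (simp add: case_prod_beta le_max_iff_disj)
next
  case (2 a b)
  show ?case by (simp add: case_prod_beta mdist_commute)
next
  case (3 a b)
  have "max s t = 0 \<longleftrightarrow> s = 0 \<and> t = 0" if "0 \<le> s" "0 \<le> t" for s t :: real
    using that by linarith
  with 3 show ?case by (cases a; cases b) simp
next
  case (4 a b c)
  have "mdist X (fst a) (fst c) \<le> mdist X (fst a) (fst b) + mdist X (fst b) (fst c)"
    "mdist Y (snd a) (snd c) \<le> mdist Y (snd a) (snd b) + mdist Y (snd b) (snd c)"
    using 4 by (auto intro!: mdist_triangle)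
  then show ?case unfolding case_prod_beta by linarith
qed

lemma mspace_max_prod_metric [simp]: "mspace (max_prod_metric X Y) = mspace X \<times> mspace Y"
  by (simp add: max_prod_metric_def Metric_space.mspace_metric[OF Metric_space_max_prod])

lemma mdist_max_prod_metric [simp]:
  "mdist (max_prod_metric X Y) (x, y) (x', y') = max (mdist X x x') (mdist Y y y')"
  by (simp add: max_prod_metric_def Metric_space.mdist_metric[OF Metric_space_max_prod])

definition boundedly_finite :: "'a metric \<Rightarrow> bool" where
  "boundedly_finite X \<longleftrightarrow>
     (\<forall>B. Metric_space.mbounded (mspace X) (mdist X) B \<longrightarrow> finite B)"

definition proper_metric :: "'a metric \<Rightarrow> bool" where
  "proper_metric X \<longleftrightarrow>
     (\<forall>B. closedin (mtopology_of X) B \<and> Metric_space.mbounded (mspace X) (mdist X) B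
        \<longrightarrow> compactin (mtopology_of X) B)"


section \<open>Connectedness at a given scale\<close>

text \<open>The scale is an extended real so that the components $X_\infty(x) = X$ and $X_{s(X)}(x)$,
  where possibly $s(X) = \infty$, need no separate treatment; see \<open>scale_component_infinity\<close>.\<close>

definition scale_connected :: "'a metric \<Rightarrow> ereal \<Rightarrow> 'a set \<Rightarrow> bool" where
  "scale_connected X \<epsilon> C \<longleftrightarrow>
     C \<subseteq> mspace X \<and>
     (\<forall>x\<in>C. \<forall>y\<in>C. \<exists>(n::nat) c. c 0 = x \<and> c n = y \<and> (\<forall>i\<le>n. c i \<in> C) \<and>
        (\<forall>i\<in>{1..n}. ereal (mdist X (c (i - 1)) (c i)) \<le> \<epsilon>))"

definition scale_component :: "'a metric \<Rightarrow> ereal \<Rightarrow> 'a \<Rightarrow> 'a set" where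
  "scale_component X \<epsilon> x = \<Union>{C. scale_connected X \<epsilon> C \<and> x \<in> C}"

lemma scale_connected_infinity: "C \<subseteq> mspace X \<Longrightarrow> scale_connected X \<infinity> C"
  unfolding scale_connected_def
proof (intro conjI ballI)
  fix x y assume "x \<in> C" "y \<in> C"
  then show "\<exists>(n::nat) c. c 0 = x \<and> c n = y \<and> (\<forall>i\<le>n. c i \<in> C) \<and>
      (\<forall>i\<in>{1..n}. ereal (mdist X (c (i - 1)) (c i)) \<le> \<infinity>)"
    by (intro exI[of _ 1] exI[of _ "\<lambda>i. if i = 0 then x else y"]) auto
qed

lemma scale_component_infinity: "x \<in> mspace X \<Longrightarrow> scale_component X \<infinity> x = mspace X"
  using scale_connected_infinity[of "mspace X" X]
  by (auto simp: scale_component_def scale_connected_def)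

lemma scale_component_maximal:
  "scale_connected X \<epsilon> C \<Longrightarrow> x \<in> C \<Longrightarrow> C \<subseteq> scale_component X \<epsilon> x"
  by (auto simp: scale_component_def)

lemma scale_connected_scale_component: "scale_connected X \<epsilon> (scale_component X \<epsilon> x)"
  unfolding scale_connected_def
proof (intro conjI ballI)
  show "scale_component X \<epsilon> x \<subseteq> mspace X"
    by (auto simp: scale_component_def scale_connected_def)
next
  fix y z assume "y \<in> scale_component X \<epsilon> x" "z \<in> scale_component X \<epsilon> x"
  then obtain C D where C: "scale_connected X \<epsilon> C" "x \<in> C" "y \<in> C"
    and D: "scale_connected X \<epsilon> D" "x \<in> D" "z \<in> D"
    by (auto simp: scale_component_def)
  have "C \<subseteq> scale_component X \<epsilon> x" "D \<subseteq> scale_component X \<epsilon> x"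
    using C D by (auto simp: scale_component_def)
  moreover obtain n :: nat and c where c: "c 0 = y" "c n = x" "\<forall>i\<le>n. c i \<in> C"
    "\<forall>i\<in>{1..n}. ereal (mdist X (c (i - 1)) (c i)) \<le> \<epsilon>"
    using C(1)[unfolded scale_connected_def, THEN conjunct2, THEN bspec, OF C(3),
        THEN bspec, OF C(2)] by blast
  moreover obtain m :: nat and d where d: "d 0 = x" "d m = z" "\<forall>i\<le>m. d i \<in> D"
    "\<forall>i\<in>{1..m}. ereal (mdist X (d (i - 1)) (d i)) \<le> \<epsilon>"
    using D(1)[unfolded scale_connected_def, THEN conjunct2, THEN bspec, OF D(2),
        THEN bspec, OF D(3)] by blast
  define e where "e i = (if i \<le> n then c i else d (i - n))" for i
  have "ereal (mdist X (e (i - 1)) (e i)) \<le> \<epsilon>" if i: "i \<in> {1..n + m}" for i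
  proof (cases "i \<le> n")
    case True
    then show ?thesis using c(4) i by (auto simp: e_def)
  next
    case False
    then have "e (i - 1) = d (i - n - 1)"
      using c(2) d(1) by (cases "i = Suc n") (auto simp: e_def)
    moreover have "ereal (mdist X (d (i - n - 1)) (d (i - n))) \<le> \<epsilon>"
      using False i by (intro bspec[OF d(4)]) auto
    moreover have "e i = d (i - n)"
      using False by (simp add: e_def)
    ultimately show ?thesis by simp
  qed
  moreover have "e 0 = y" "e (n + m) = z"
    using c(1,2) d(1,2) by (auto simp: e_def)
  ultimately show "\<exists>(n::nat) c. c 0 = y \<and> c n = z \<and> (\<forall>i\<le>n. c i \<in> scale_component X \<epsilon> x) \<and>
      (\<forall>i\<in>{1..n}. ereal (mdist X (c (i - 1)) (c i)) \<le> \<epsilon>)"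
    using c(3) d(3) by (intro exI[of _ "n + m"] exI[of _ e]) (auto simp: e_def)
qed

definition large_scale_connected :: "'a metric \<Rightarrow> 'a set \<Rightarrow> bool" where
  "large_scale_connected X C \<longleftrightarrow> (\<exists>\<epsilon>\<ge>0. scale_connected X (ereal \<epsilon>) C)"

definition shift_homogeneous :: "'a metric \<Rightarrow> bool" where
  "shift_homogeneous X \<longleftrightarrow>
     (\<forall>x\<in>mspace X. \<forall>y\<in>mspace X. \<exists>f.
        bij_betw f (mspace X) (mspace X) \<and>
        (\<forall>u\<in>mspace X. \<forall>v\<in>mspace X. mdist X (f u) (f v) = mdist X u v) \<and>
        f x = y \<and>
        (\<forall>C. large_scale_connected X C \<longrightarrow> (SUP c\<in>C. ereal (mdist X (f c) c)) < \<infinity>))"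


section \<open>Factorizing step and factorizing function\<close>

definition factorizing_step :: "'a metric \<Rightarrow> ereal" where
  "factorizing_step X =
     Inf ({\<infinity>} \<union> {ereal \<epsilon> | \<epsilon>. \<epsilon> \<ge> 0 \<and>
       (\<forall>\<delta>\<ge>\<epsilon>. \<forall>x\<in>mspace X.
          finite {scale_component X (ereal \<epsilon>) y | y. y \<in> scale_component X (ereal \<delta>) x})})"

text \<open>The component $X_\delta$ below is that of an arbitrary point \<open>x\<^sub>0\<close>; for homogeneous
  spaces the cardinality does not depend on \<open>x\<^sub>0\<close>.  For boundedly-finite homogeneous spaces the
  sets of components are finite, so the convention that \<^const>\<open>card\<close> is 0 on infinite sets
  plays no role.\<close>

definition factorizing_function :: "'a metric \<Rightarrow> nat \<Rightarrow> enat" where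
  "factorizing_function X p =
     Sup {enat k | k. \<exists>\<delta>\<ge>0. \<exists>x\<^sub>0\<in>mspace X.
       p ^ k dvd card {scale_component X (factorizing_step X) x | x.
                         x \<in> scale_component X (ereal \<delta>) x\<^sub>0}}"


section \<open>The groups $\mathbb{Z}_\phi$\<close>

definition cyclic_power :: "nat \<Rightarrow> enat \<Rightarrow> (nat \<Rightarrow> int) monoid" where
  "cyclic_power p n = sum_group {i. enat i < n} (\<lambda>_. integer_mod_group p)"

text \<open>Only the values of \<open>\<phi>\<close> at primes matter.\<close>

definition Z_group :: "(nat \<Rightarrow> enat) \<Rightarrow> (nat \<Rightarrow> nat \<Rightarrow> int) monoid" where
  "Z_group \<phi> = sum_group {p. prime p} (\<lambda>p. cyclic_power p (\<phi> p))"

definition proper_left_invariant_metric :: "('a, 'b) monoid_scheme \<Rightarrow> 'a metric \<Rightarrow> bool" where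
  "proper_left_invariant_metric G \<rho> \<longleftrightarrow>
     mspace \<rho> = carrier G \<and>
     (\<forall>g\<in>carrier G. \<forall>x\<in>carrier G. \<forall>y\<in>carrier G.
        mdist \<rho> (g \<otimes>\<^bsub>G\<^esub> x) (g \<otimes>\<^bsub>G\<^esub> y) = mdist \<rho> x y) \<and>
     proper_metric \<rho>"

end

theory Submission
  imports Defs
begin

text \<open>
  Let \<open>s\<close> be the factorizing step and, for a natural number \<open>n\<close>, let \<open>K n y\<close> be the component of
  the point \<open>y\<close> at scale \<open>s + n\<close>.  The partitions of the space into these components become
  coarser with \<open>n\<close>, and any two points at distance at most \<open>n\<close> have the same \<open>K n\<close>.  By homogeneity
  each \<open>K n y\<close> consists of the same number \<open>m n\<close> of components at scale \<open>s\<close>.  This number is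
  finite because the infimum \<open>s\<close> is attained (\<open>finite_factorizing_components\<close>), \<open>m n\<close> divides
  \<open>m (n + 1)\<close>, and \<open>\<phi> p\<close> is the supremum of the exponents of \<open>p\<close> in the numbers
  \<open>m n\<close>.  The coarse isomorphism has two coordinates.

  As to the coordinate in \<open>\<int>\<^sub>\<phi>\<close>, the elements of \<open>\<int>\<^sub>\<phi>\<close> with support in the first \<open>v\<close> copies of
  \<open>\<int>/p\<int>\<close>, where \<open>v\<close> is the exponent of \<open>p\<close> in \<open>m n\<close>, form a finite subgroup of order \<open>m n\<close>.
  These subgroups increase from the trivial group and exhaust \<open>\<int>\<^sub>\<phi>\<close>.  So the cosets partition the
  group with the same counts as the components partition the space, and towers of partitions with
  equal counts are isomorphic (\<open>tower_map_exists\<close>): there is a map \<open>\<theta>\<close> from the space onto the group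
  under which components at scale \<open>s + n\<close> correspond exactly to cosets of the \<open>n\<close>-th subgroup.
  Cosets of one subgroup are uniformly bounded, and each ball of the group around the identity lies in
  some subgroup of the sequence, because balls are finite.  The latter holds since a proper
  left-invariant metric on a countable group is discrete by Baire's theorem
  (\<open>proper_left_invariant_finite_ball\<close>).

  For the coordinate in \<open>K 0 x\<close> a map \<open>core\<close> is needed that takes every component at scale
  \<open>s\<close> bijectively onto \<open>K 0 x\<close> and changes the distances of points with a common \<open>K n\<close> by a bounded
  amount, with a bound depending on \<open>n\<close> alone (\<open>core_almost_isometry\<close>).  Choosing a shift isometry for each
  component separately would give no common bound, since there may be infinitely many of
  them.  Instead the map is built along the tower.  The component \<open>K (n + 1) x\<close> is a finite
  union of components at scale \<open>s + n\<close>, each of which is carried onto \<open>K n x\<close> by a shift isometry.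
  These finitely many isometries displace points by a bounded amount on those components, provided
  \<open>s\<close> is finite; for infinite \<open>s\<close> there is only one component.  Repeating the
  step brings each point into \<open>K 0 x\<close>, and on \<open>K n x\<close> the total displacement is bounded.  Two points of
  any other component at scale \<open>s + n\<close> are carried by one and the same isometry at each step until
  they reach \<open>K n x\<close>, so the bound obtained there applies to them as well.
\<close>

section \<open>Components at a given scale\<close>

lemma scale_component_subset: "scale_component X \<epsilon> x \<subseteq> mspace X"
  using scale_connected_scale_component[of X \<epsilon> x] by (simp add: scale_connected_def)

lemma scale_component_self:
  assumes "x \<in> mspace X" shows "x \<in> scale_component X \<epsilon> x"
proof -
  have "scale_connected X \<epsilon> {x}"
    using assms unfolding scale_connected_def
    by (auto intro!: exI[of _ "0::nat"] exI[of _ "\<lambda>_. x"])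
  then show ?thesis by (auto simp: scale_component_def)
qed

lemma scale_component_eq:
  assumes "y \<in> scale_component X \<epsilon> x" shows "scale_component X \<epsilon> y = scale_component X \<epsilon> x"
proof -
  have "scale_component X \<epsilon> x \<subseteq> scale_component X \<epsilon> y"
    by (intro scale_component_maximal scale_connected_scale_component assms)
  moreover from assms obtain C where "scale_connected X \<epsilon> C" "x \<in> C" "y \<in> C"
    by (auto simp: scale_component_def)
  then have "x \<in> scale_component X \<epsilon> y"
    by (auto simp: scale_component_def)
  then have "scale_component X \<epsilon> y \<subseteq> scale_component X \<epsilon> x"
    by (intro scale_component_maximal scale_connected_scale_component)
  ultimately show ?thesis by blast
qed

lemma scale_component_eq_iff:
  assumes "y \<in> mspace X"
  shows "scale_component X \<epsilon> y = scale_component X \<epsilon> x \<longleftrightarrow> y \<in> scale_component X \<epsilon> x"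
proof
  assume "scale_component X \<epsilon> y = scale_component X \<epsilon> x"
  with scale_component_self[OF assms, of \<epsilon>] show "y \<in> scale_component X \<epsilon> x" by simp
qed (rule scale_component_eq)

lemma scale_connectedE:
  assumes "scale_connected X \<epsilon> C" "x \<in> C" "y \<in> C"
  obtains n :: nat and c where "c 0 = x" "c n = y" "\<And>i. i \<le> n \<Longrightarrow> c i \<in> C"
    "\<And>i. i \<in> {1..n} \<Longrightarrow> ereal (mdist X (c (i - 1)) (c i)) \<le> \<epsilon>"
  using assms unfolding scale_connected_def by metis

text \<open>Chains only see which distances are at most the scale.\<close>

lemma scale_connected_change_scale:
  assumes "scale_connected X \<epsilon> C"
    and le: "\<And>u v. u \<in> mspace X \<Longrightarrow> v \<in> mspace X \<Longrightarrow>
      ereal (mdist X u v) \<le> \<epsilon> \<Longrightarrow> ereal (mdist X u v) \<le> \<epsilon>'"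
  shows "scale_connected X \<epsilon>' C"
  unfolding scale_connected_def
proof (intro conjI ballI)
  show C: "C \<subseteq> mspace X" using assms(1) by (simp add: scale_connected_def)
  fix x y assume "x \<in> C" "y \<in> C"
  with assms(1) obtain n :: nat and c where c: "c 0 = x" "c n = y" "\<And>i. i \<le> n \<Longrightarrow> c i \<in> C"
    "\<And>i. i \<in> {1..n} \<Longrightarrow> ereal (mdist X (c (i - 1)) (c i)) \<le> \<epsilon>"
    by (rule scale_connectedE) blast
  have "ereal (mdist X (c (i - 1)) (c i)) \<le> \<epsilon>'" if "i \<in> {1..n}" for i
    using that c(3)[of "i - 1"] c(3)[of i] c(4)[OF that] C by (intro le) auto
  with c(1-3) show "\<exists>(n::nat) c. c 0 = x \<and> c n = y \<and> (\<forall>i\<le>n. c i \<in> C) \<and>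
    (\<forall>i\<in>{1..n}. ereal (mdist X (c (i - 1)) (c i)) \<le> \<epsilon>')"
    by blast
qed

lemma scale_component_mono:
  "\<epsilon> \<le> \<epsilon>' \<Longrightarrow> scale_component X \<epsilon> x \<subseteq> scale_component X \<epsilon>' x"
  unfolding scale_component_def by (blast intro: scale_connected_change_scale order_trans)

lemma scale_component_eq_mono:
  assumes "scale_component X \<epsilon> x = scale_component X \<epsilon> y" "\<epsilon> \<le> \<epsilon>'" "x \<in> mspace X"
  shows "scale_component X \<epsilon>' x = scale_component X \<epsilon>' y"
  using assms scale_component_mono[OF assms(2), of X y] scale_component_self[OF assms(3), of \<epsilon>]
  by (intro scale_component_eq) auto

lemma scale_component_close:
  assumes "x \<in> mspace X" "y \<in> mspace X" "ereal (mdist X x y) \<le> \<epsilon>"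
  shows "scale_component X \<epsilon> x = scale_component X \<epsilon> y"
proof -
  have "0 \<le> \<epsilon>" using assms(3) by (rule order_trans[rotated]) simp
  moreover have "mdist X x x = 0" "mdist X y y = 0"
    using assms(1,2) by simp_all
  ultimately have \<epsilon>: "ereal (mdist X x x) \<le> \<epsilon>" "ereal (mdist X y y) \<le> \<epsilon>"
    by (simp_all add: zero_ereal_def)
  have "scale_connected X \<epsilon> {x, y}"
    unfolding scale_connected_def
  proof (intro conjI ballI)
    fix u v assume uv: "u \<in> {x, y}" "v \<in> {x, y}"
    then show "\<exists>(n::nat) c. c 0 = u \<and> c n = v \<and> (\<forall>i\<le>n. c i \<in> {x, y}) \<and>
        (\<forall>i\<in>{1..n}. ereal (mdist X (c (i - 1)) (c i)) \<le> \<epsilon>)"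
      using assms \<epsilon>
      by (intro exI[of _ "1::nat"] exI[of _ "\<lambda>i. if i = 0 then u else v"])
        (auto simp: mdist_commute[of X y x])
  qed (use assms in auto)
  then have "x \<in> scale_component X \<epsilon> y" by (auto simp: scale_component_def)
  then show ?thesis by (rule scale_component_eq)
qed

text \<open>With this the infimum in the factorizing step can be compared with an admissible scale close to it.\<close>

lemma scale_component_cong:
  assumes "\<And>u v. u \<in> mspace X \<Longrightarrow> v \<in> mspace X \<Longrightarrow>
    ereal (mdist X u v) \<le> \<epsilon> \<longleftrightarrow> ereal (mdist X u v) \<le> \<epsilon>'"
  shows "scale_component X \<epsilon> x = scale_component X \<epsilon>' x"
proof -
  have "scale_connected X \<epsilon> C \<longleftrightarrow> scale_connected X \<epsilon>' C" for C
    using scale_connected_change_scale[of X \<epsilon> C \<epsilon>'] scale_connected_change_scale[of X \<epsilon>' C \<epsilon>] assms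
    by blast
  then show ?thesis by (simp add: scale_component_def)
qed


section \<open>Isometries\<close>

definition self_isometry :: "'a metric \<Rightarrow> ('a \<Rightarrow> 'a) \<Rightarrow> bool" where
  "self_isometry X f \<longleftrightarrow> bij_betw f (mspace X) (mspace X) \<and>
     (\<forall>u\<in>mspace X. \<forall>v\<in>mspace X. mdist X (f u) (f v) = mdist X u v)"

lemma self_isometry_in: "self_isometry X f \<Longrightarrow> u \<in> mspace X \<Longrightarrow> f u \<in> mspace X"
  by (auto simp: self_isometry_def bij_betw_def)

lemma self_isometry_dist:
  "self_isometry X f \<Longrightarrow> u \<in> mspace X \<Longrightarrow> v \<in> mspace X \<Longrightarrow> mdist X (f u) (f v) = mdist X u v"
  by (auto simp: self_isometry_def)

lemma self_isometry_inverse: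
  assumes "self_isometry X f"
  obtains g where "self_isometry X g" "\<And>u. u \<in> mspace X \<Longrightarrow> g (f u) = u"
    "\<And>u. u \<in> mspace X \<Longrightarrow> f (g u) = u"
proof
  let ?g = "inv_into (mspace X) f"
  have f: "bij_betw f (mspace X) (mspace X)" using assms by (simp add: self_isometry_def)
  show gf: "\<And>u. u \<in> mspace X \<Longrightarrow> ?g (f u) = u" using bij_betw_inv_into_left[OF f] .
  show fg: "\<And>u. u \<in> mspace X \<Longrightarrow> f (?g u) = u" using bij_betw_inv_into_right[OF f] .
  have g: "bij_betw ?g (mspace X) (mspace X)" by (rule bij_betw_inv_into[OF f])
  have "mdist X (?g u) (?g v) = mdist X u v" if "u \<in> mspace X" "v \<in> mspace X" for u v
    using self_isometry_dist[OF assms, of "?g u" "?g v"] that fg bij_betwE[OF g] by auto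
  with g show "self_isometry X ?g" by (simp add: self_isometry_def)
qed

lemma scale_connected_isometry_image:
  assumes f: "self_isometry X f" and C: "scale_connected X \<epsilon> C"
  shows "scale_connected X \<epsilon> (f ` C)"
  unfolding scale_connected_def
proof (intro conjI ballI)
  have CX: "C \<subseteq> mspace X" using C by (simp add: scale_connected_def)
  then show "f ` C \<subseteq> mspace X" using self_isometry_in[OF f] by auto
  fix x' y' assume "x' \<in> f ` C" "y' \<in> f ` C"
  then obtain x y where xy: "x \<in> C" "y \<in> C" "x' = f x" "y' = f y" by blast
  with C obtain n :: nat and c where c: "c 0 = x" "c n = y" "\<And>i. i \<le> n \<Longrightarrow> c i \<in> C"
    "\<And>i. i \<in> {1..n} \<Longrightarrow> ereal (mdist X (c (i - 1)) (c i)) \<le> \<epsilon>"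
    by (auto elim: scale_connectedE)
  have "mdist X (f (c (i - 1))) (f (c i)) = mdist X (c (i - 1)) (c i)" if "i \<in> {1..n}" for i
    using c(3) that CX by (intro self_isometry_dist[OF f]) auto
  then show "\<exists>(n::nat) c. c 0 = x' \<and> c n = y' \<and> (\<forall>i\<le>n. c i \<in> f ` C) \<and>
      (\<forall>i\<in>{1..n}. ereal (mdist X (c (i - 1)) (c i)) \<le> \<epsilon>)"
    using c xy by (intro exI[of _ n] exI[of _ "\<lambda>i. f (c i)"]) auto
qed

lemma scale_component_isometry_image:
  assumes f: "self_isometry X f" and x: "x \<in> mspace X"
  shows "scale_component X \<epsilon> (f x) = f ` scale_component X \<epsilon> x"
proof -
  have sub: "g ` scale_component X \<epsilon> y \<subseteq> scale_component X \<epsilon> (g y)"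
    if "self_isometry X g" "y \<in> mspace X" for g y
    using that scale_component_self[of y X \<epsilon>]
    by (intro scale_component_maximal scale_connected_isometry_image
        scale_connected_scale_component) auto
  obtain g where g: "self_isometry X g" "\<And>u. u \<in> mspace X \<Longrightarrow> g (f u) = u"
    "\<And>u. u \<in> mspace X \<Longrightarrow> f (g u) = u"
    using self_isometry_inverse[OF f] by blast
  have "scale_component X \<epsilon> (f x) \<subseteq> f ` scale_component X \<epsilon> x"
  proof
    fix y assume y: "y \<in> scale_component X \<epsilon> (f x)"
    then have "g y \<in> scale_component X \<epsilon> x"
      using sub[OF g(1) self_isometry_in[OF f x]] g(2)[OF x] by auto
    then show "y \<in> f ` scale_component X \<epsilon> x"
      using g(3) y scale_component_subset[of X \<epsilon> "f x"] by (metis image_eqI subsetD)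
  qed
  with sub[OF f x] show ?thesis by blast
qed

lemma scale_component_isometry_eq_iff:
  assumes f: "self_isometry X f" and "x \<in> mspace X" "y \<in> mspace X"
  shows "scale_component X \<epsilon> (f x) = scale_component X \<epsilon> (f y)
    \<longleftrightarrow> scale_component X \<epsilon> x = scale_component X \<epsilon> y"
proof -
  have "inj_on f (mspace X)" using f by (simp add: self_isometry_def bij_betw_def)
  then show ?thesis
    using inj_on_image_eq_iff[OF _ scale_component_subset scale_component_subset]
    by (simp add: scale_component_isometry_image assms)
qed

definition homogeneous :: "'a metric \<Rightarrow> bool" where
  "homogeneous X \<longleftrightarrow> (\<forall>x\<in>mspace X. \<forall>y\<in>mspace X. \<exists>f. self_isometry X f \<and> f x = y)"

lemma homogeneousE:
  assumes "homogeneous X" "x \<in> mspace X" "y \<in> mspace X"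
  obtains f where "self_isometry X f" "f x = y"
  using assms unfolding homogeneous_def by blast

text \<open>Components at a finite scale are large scale connected; they are the only sets on which the
  bounded displacement of shift isometries is used.\<close>

lemma shift_homogeneousE:
  assumes "shift_homogeneous X" "x \<in> mspace X" "y \<in> mspace X"
  obtains f where "self_isometry X f" "f x = y"
    "\<And>\<epsilon> z. \<epsilon> \<noteq> \<infinity> \<Longrightarrow> 0 \<le> \<epsilon> \<Longrightarrow>
       \<exists>L. \<forall>c\<in>scale_component X \<epsilon> z. mdist X (f c) c \<le> L"
proof -
  obtain f where f: "self_isometry X f" "f x = y"
    "\<And>C. large_scale_connected X C \<Longrightarrow> (SUP c\<in>C. ereal (mdist X (f c) c)) < \<infinity>"
    using assms unfolding shift_homogeneous_def self_isometry_def by blast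
  have "\<exists>L. \<forall>c\<in>scale_component X \<epsilon> z. mdist X (f c) c \<le> L" if \<epsilon>: "\<epsilon> \<noteq> \<infinity>" "0 \<le> \<epsilon>" for \<epsilon> z
  proof -
    obtain e where e: "\<epsilon> = ereal e" "0 \<le> e" using \<epsilon> by (cases \<epsilon>) auto
    then have "large_scale_connected X (scale_component X \<epsilon> z)"
      unfolding large_scale_connected_def using scale_connected_scale_component by metis
    then have "(SUP c\<in>scale_component X \<epsilon> z. ereal (mdist X (f c) c)) \<noteq> \<infinity>"
      using f(3) by force
    then obtain n :: nat where "(SUP c\<in>scale_component X \<epsilon> z. ereal (mdist X (f c) c)) < ereal n"
      using less_PInf_Ex_of_nat by blast
    then have "(SUP c\<in>scale_component X \<epsilon> z. ereal (mdist X (f c) c)) \<le> ereal n"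
      by (rule less_imp_le)
    then have "\<forall>c\<in>scale_component X \<epsilon> z. mdist X (f c) c \<le> real n"
      by (simp add: SUP_le_iff)
    then show ?thesis by blast
  qed
  with f(1,2) show ?thesis by (rule that)
qed

lemma shift_homogeneous_imp_homogeneous:
  assumes "shift_homogeneous X" shows "homogeneous X"
  unfolding homogeneous_def
proof (intro ballI)
  fix x y assume "x \<in> mspace X" "y \<in> mspace X"
  with assms obtain f where "self_isometry X f" "f x = y" by (rule shift_homogeneousE)
  then show "\<exists>f. self_isometry X f \<and> f x = y" by blast
qed


section \<open>Counting components\<close>

lemma finite_image_refine:
  assumes "finite (f ` B)"
    and refine: "\<And>a b. a \<in> B \<Longrightarrow> b \<in> B \<Longrightarrow> f a = f b \<Longrightarrow> g a = g b"
  shows "finite (g ` B)"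
proof -
  have "g b = g (inv_into B f (f b))" if "b \<in> B" for b
    using that by (intro refine) (auto intro: inv_into_into f_inv_into_f[symmetric])
  then have "g ` B \<subseteq> (\<lambda>z. g (inv_into B f z)) ` f ` B" by auto
  then show ?thesis using assms(1) by (rule finite_surj[rotated])
qed

text \<open>This count governs the growth of the number of components with the scale, and the number of
  subclasses in the towers below.\<close>

lemma card_image_refine:
  assumes "finite (f ` B)"
    and refine: "\<And>a b. a \<in> B \<Longrightarrow> b \<in> B \<Longrightarrow> f a = f b \<Longrightarrow> g a = g b"
    and k: "\<And>b. b \<in> B \<Longrightarrow> card (f ` {a \<in> B. g a = g b}) = k"
  shows "k * card (g ` B) = card (f ` B)"
proof -
  define F where "F l = f ` {a \<in> B. g a = l}" for l
  have disj: "F l \<inter> F l' = {}" if "l \<noteq> l'" for l l'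
  proof (rule ccontr)
    assume "F l \<inter> F l' \<noteq> {}"
    then obtain a b where "a \<in> B" "g a = l" "b \<in> B" "g b = l'" "f a = f b"
      by (auto simp: F_def)
    with refine that show False by blast
  qed
  have ne: "F l \<noteq> {}" if "l \<in> g ` B" for l
    using that by (auto simp: F_def)
  have inj: "inj_on F (g ` B)"
    using disj ne by (metis Int_absorb inj_onI)
  have un: "\<Union> (F ` g ` B) = f ` B"
    by (auto simp: F_def)
  have "finite (F ` g ` B)"
    using assms(1) un by (metis finite_UnionD)
  then have "k * card (F ` g ` B) = card (\<Union> (F ` g ` B))"
  proof (intro card_partition)
    show "card C = k" if "C \<in> F ` g ` B" for C
      using that k by (auto simp: F_def)
    show "C \<inter> C' = {}" if C: "C \<in> F ` g ` B" "C' \<in> F ` g ` B" "C \<noteq> C'" for C C'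
    proof -
      obtain l l' where "C = F l" "C' = F l'" using C by blast
      with C(3) show ?thesis using disj by metis
    qed
  qed (use assms(1) un in simp_all)
  then show ?thesis
    using un inj by (simp add: card_image)
qed

abbreviation components :: "'a metric \<Rightarrow> ereal \<Rightarrow> ereal \<Rightarrow> 'a \<Rightarrow> 'a set set" where
  "components X \<epsilon> \<delta> x \<equiv> scale_component X \<epsilon> ` scale_component X \<delta> x"

lemma components_trivial:
  assumes "x \<in> mspace X" "\<delta> \<le> \<epsilon>" shows "components X \<epsilon> \<delta> x = {scale_component X \<epsilon> x}"
  using scale_component_self[OF assms(1), of \<delta>] scale_component_mono[OF assms(2), of X x]
    scale_component_eq[of _ X \<epsilon> x] by auto

lemma card_components_homogeneous:
  assumes "homogeneous X" "x \<in> mspace X" "y \<in> mspace X"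
  shows "card (components X \<epsilon> \<delta> x) = card (components X \<epsilon> \<delta> y)"
proof -
  obtain f where f: "self_isometry X f" "f x = y"
    using homogeneousE[OF assms] .
  have inj: "inj_on f (mspace X)" using f by (simp add: self_isometry_def bij_betw_def)
  have "inj_on ((`) f) (components X \<epsilon> \<delta> x)"
    using inj_on_image_eq_iff[OF inj scale_component_subset scale_component_subset]
    by (auto simp: inj_on_def)
  moreover have "scale_component X \<epsilon> (f u) = f ` scale_component X \<epsilon> u"
    if "u \<in> scale_component X \<delta> x" for u
    using subsetD[OF scale_component_subset that] by (rule scale_component_isometry_image[OF f(1)])
  then have "components X \<epsilon> \<delta> y = (`) f ` components X \<epsilon> \<delta> x"
    using scale_component_isometry_image[OF f(1) assms(2), of \<delta>] f(2) by (simp add: image_image)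
  ultimately show ?thesis by (simp add: card_image)
qed

text \<open>By homogeneity all \<open>\<delta>\<close>-components inside a \<open>\<delta>'\<close>-component are split into equally many
  \<open>\<epsilon>\<close>-components.\<close>

lemma card_components_dvd:
  assumes "homogeneous X" "x \<in> mspace X" "\<epsilon> \<le> \<delta>" "\<delta> \<le> \<delta>'" "finite (components X \<epsilon> \<delta>' x)"
  shows "card (components X \<epsilon> \<delta> x) dvd card (components X \<epsilon> \<delta>' x)"
proof -
  let ?B = "scale_component X \<delta>' x"
  have B: "?B \<subseteq> mspace X" by (rule scale_component_subset)
  have "{a \<in> ?B. scale_component X \<delta> a = scale_component X \<delta> b} = scale_component X \<delta> b"
    if "b \<in> ?B" for b
    using that B scale_component_eq_iff[of _ X \<delta> b] scale_component_mono[OF assms(4), of X b]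
      scale_component_eq[OF that] scale_component_subset[of X \<delta> b] by blast
  moreover have "card (components X \<epsilon> \<delta> b) = card (components X \<epsilon> \<delta> x)" if "b \<in> ?B" for b
    using that B assms(1,2) by (intro card_components_homogeneous) auto
  ultimately have "card (components X \<epsilon> \<delta> x) * card (scale_component X \<delta> ` ?B)
      = card (components X \<epsilon> \<delta>' x)"
  proof (intro card_image_refine assms(5))
    fix a b assume "a \<in> ?B" "scale_component X \<epsilon> a = scale_component X \<epsilon> b"
    then show "scale_component X \<delta> a = scale_component X \<delta> b"
      using B by (intro scale_component_eq_mono[OF _ assms(3)]) auto
  qed simp
  then show ?thesis by (metis dvd_triv_left)
qed

lemma factorizing_step_nonneg: "0 \<le> factorizing_step X"
  unfolding factorizing_step_def by (rule Inf_greatest) auto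

text \<open>The infimum defining the factorizing step is attained: balls are finite and all points look
  alike, so no distance of the space lies just above the infimum, and the components at the
  infimum are those at an admissible scale.\<close>

lemma finite_factorizing_components:
  assumes bf: "boundedly_finite X" and hom: "homogeneous X" and x: "x \<in> mspace X"
    and \<delta>: "\<delta> < \<infinity> \<or> factorizing_step X = \<infinity>"
  shows "finite (components X (factorizing_step X) \<delta> x)"
proof (cases "factorizing_step X = \<infinity>")
  case True
  then show ?thesis using components_trivial[OF x, of \<delta> \<infinity>] by simp
next
  case False
  then obtain s where s: "factorizing_step X = ereal s" "0 \<le> s"
    using factorizing_step_nonneg[of X] by (cases "factorizing_step X") auto
  interpret M: Metric_space "mspace X" "mdist X" by (rule Metric_space_mspace_mdist)
  \<comment> \<open>\<open>Min D\<close> is the least distance above \<open>s\<close>, or \<open>s + 1\<close> if that is smaller.\<close>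
  define D where "D = insert (s + 1) {r \<in> mdist X x ` M.mcball x (s + 1). s < r}"
  have "finite (M.mcball x (s + 1))"
    using bf M.mbounded_mcball unfolding boundedly_finite_def by blast
  then have fin: "finite D" unfolding D_def by simp
  have gt: "s < Min D" using fin by (subst Min_gr_iff) (auto simp: D_def)
  have gap: "Min D \<le> mdist X u v" if "u \<in> mspace X" "v \<in> mspace X" "s < mdist X u v" for u v
  proof -
    obtain f where f: "self_isometry X f" "f u = x" using homogeneousE[OF hom \<open>u \<in> mspace X\<close> x] .
    have eq: "mdist X x (f v) = mdist X u v" using f self_isometry_dist that by metis
    have "mdist X u v \<in> D" if "mdist X u v \<le> s + 1"
      using that \<open>s < mdist X u v\<close> eq self_isometry_in[OF f(1) \<open>v \<in> mspace X\<close>] x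
      by (auto simp: D_def intro!: image_eqI[of _ _ "f v"])
    moreover have "s + 1 \<in> D" by (simp add: D_def)
    ultimately show ?thesis using Min_le[OF fin] by (metis linorder_le_cases order_trans)
  qed
  have "factorizing_step X < ereal (Min D)" using s gt by simp
  then obtain e where e: "e \<ge> 0" "ereal e < ereal (Min D)"
    "\<forall>\<delta>\<ge>e. \<forall>x\<in>mspace X.
          finite {scale_component X (ereal e) y | y. y \<in> scale_component X (ereal \<delta>) x}"
    unfolding factorizing_step_def Inf_less_iff by auto
  then have "factorizing_step X \<le> ereal e"
    unfolding factorizing_step_def by (intro Inf_lower) blast
  then have se: "s \<le> e" by (simp add: s)
  have "scale_component X s y = scale_component X e y" for y
  proof (rule scale_component_cong)
    fix u v assume "u \<in> mspace X" "v \<in> mspace X"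
    from gap[OF this] se e(2) show "ereal (mdist X u v) \<le> ereal s \<longleftrightarrow> ereal (mdist X u v) \<le> ereal e"
      by force
  qed
  moreover obtain d where d: "e \<le> d" "\<delta> \<le> ereal d"
  proof (cases \<delta>)
    case (real r)
    then show ?thesis by (intro that[of "max e r"]) auto
  next
    case PInf
    then show ?thesis using \<delta> False by simp
  next
    case MInf
    then show ?thesis by (intro that[of e]) auto
  qed
  have "finite (components X e d x)" using e(3) d(1) x by (simp add: Setcompr_eq_image)
  ultimately show ?thesis
    using finite_subset[OF image_mono[OF scale_component_mono[OF d(2), of X x]]] s(1) by simp
qed

lemma le_factorizing_scale: "ereal (real n) \<le> factorizing_step X + ereal (real n)"
  using factorizing_step_nonneg[of X] by (simp add: add_increasing)

lemma finite_factorizing_components_step: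
  assumes "boundedly_finite X" "homogeneous X" "x \<in> mspace X"
  shows "finite (components X (factorizing_step X) (factorizing_step X + ereal (real n)) x)"
  using assms by (intro finite_factorizing_components) auto

text \<open>The sequence that links the space with the group: it counts the factorizing components inside
  larger and larger components, and its prime exponents grow to the factorizing function.\<close>

definition component_count :: "'a metric \<Rightarrow> 'a \<Rightarrow> nat \<Rightarrow> nat" where
  "component_count X x n =
     card (components X (factorizing_step X) (factorizing_step X + ereal (real n)) x)"

lemma component_count_pos:
  assumes "boundedly_finite X" "homogeneous X" "x \<in> mspace X"
  shows "0 < component_count X x n"
  using finite_factorizing_components_step[OF assms] scale_component_self[OF assms(3)]
  unfolding component_count_def by (auto simp: card_gt_0_iff)

lemma component_count_0:
  assumes "x \<in> mspace X" shows "component_count X x 0 = 1"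
  using components_trivial[OF assms, of "factorizing_step X" "factorizing_step X"]
  by (simp add: component_count_def flip: zero_ereal_def)

lemma component_count_dvd:
  assumes "boundedly_finite X" "homogeneous X" "x \<in> mspace X" "n \<le> n'"
  shows "component_count X x n dvd component_count X x n'"
  unfolding component_count_def using assms
  by (intro card_components_dvd finite_factorizing_components_step add_left_mono)
    (auto simp: add_increasing2)

text \<open>The supremum in the factorizing function may be taken over the scales
  \<open>factorizing_step X + n\<close>, which make sense even for an infinite factorizing step; the next two
  lemmas are the two inequalities.\<close>

lemma multiplicity_component_count_le:
  assumes "x \<in> mspace X"
  shows "enat (multiplicity p (component_count X x n)) \<le> factorizing_function X p"
proof (cases "factorizing_step X")
  case (real s)
  then have "0 \<le> s" using factorizing_step_nonneg[of X] by simp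
  have "p ^ multiplicity p (component_count X x n) dvd component_count X x n"
    by (rule multiplicity_dvd)
  then show ?thesis
    unfolding factorizing_function_def component_count_def
    using real \<open>0 \<le> s\<close> assms
    by (intro Sup_upper) (auto intro!: exI[of _ "s + real n"] bexI[of _ x] simp: Setcompr_eq_image)
next
  case PInf
  then have "component_count X x n = 1"
    using components_trivial[OF assms, of \<infinity> \<infinity>] by (simp add: component_count_def)
  then show ?thesis by (simp add: zero_enat_def[symmetric])
next
  case MInf
  then show ?thesis using factorizing_step_nonneg[of X] by simp
qed

lemma less_factorizing_functionD:
  assumes bf: "boundedly_finite X" and hom: "homogeneous X" and x: "x \<in> mspace X"
    and p: "prime p" and j: "enat j < factorizing_function X p"
  shows "\<exists>n. j < multiplicity p (component_count X x n)"
proof -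
  let ?s = "factorizing_step X"
  obtain k \<delta> x1 where k: "j < k" "0 \<le> \<delta>" "x1 \<in> mspace X" "p ^ k dvd card (components X ?s (ereal \<delta>) x1)"
    using j unfolding factorizing_function_def less_Sup_iff by (auto simp: Setcompr_eq_image)
  obtain n :: nat where n: "\<delta> \<le> real n" using real_arch_simple by blast
  have "card (components X ?s (ereal \<delta>) x1) = card (components X ?s (ereal \<delta>) x)"
    by (rule card_components_homogeneous[OF hom k(3) x])
  also have "\<dots> dvd component_count X x n"
  proof (cases "?s \<le> ereal \<delta>")
    case True
    have "ereal \<delta> \<le> ?s + ereal (real n)"
      using n le_factorizing_scale[of n X] by (meson ereal_less_eq(3) order_trans)
    with True show ?thesis unfolding component_count_def
      by (intro card_components_dvd finite_factorizing_components_step assms)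
  next
    case False
    then show ?thesis using components_trivial[OF x, of "ereal \<delta>" ?s] by simp
  qed
  finally have "p ^ k dvd component_count X x n" using k(4) by (rule dvd_trans[rotated])
  then have "k \<le> multiplicity p (component_count X x n)"
    using component_count_pos[OF bf hom x] p
    by (intro multiplicity_geI) (auto simp: prime_nat_iff)
  with k(1) show ?thesis by (meson less_le_trans)
qed


section \<open>Towers of finite partitions\<close>

text \<open>A sequence of coarser and coarser partitions of a set, each given by a labelling, that
  eventually joins any two points.  The number \<open>m n\<close> of classes of the finest partition inside a
  class of the \<open>n\<close>-th one is finite and does not depend on the class.  The space, partitioned into
  components, and the group, partitioned into cosets of finite subgroups, are both of this kind.\<close>

locale tower =
  fixes A :: "'a set" and c :: "nat \<Rightarrow> 'a \<Rightarrow> 'b" and m :: "nat \<Rightarrow> nat"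
  assumes nonempty: "A \<noteq> {}"
    and coarser: "\<And>n a b. a \<in> A \<Longrightarrow> b \<in> A \<Longrightarrow> c n a = c n b \<Longrightarrow> c (Suc n) a = c (Suc n) b"
    and exhausting: "\<And>a b. a \<in> A \<Longrightarrow> b \<in> A \<Longrightarrow> \<exists>n. c n a = c n b"
    and card_class: "\<And>n a. a \<in> A \<Longrightarrow> card (c 0 ` {b \<in> A. c n b = c n a}) = m n"
    and m_pos: "\<And>n. 0 < m n"
begin

lemma coarser_le: "n \<le> k \<Longrightarrow> a \<in> A \<Longrightarrow> b \<in> A \<Longrightarrow> c n a = c n b \<Longrightarrow> c k a = c k b"
  by (induction k rule: dec_induct) (auto intro: coarser)

lemma card_subclasses:
  assumes "a \<in> A"
  shows "card (c n ` {b \<in> A. c (Suc n) b = c (Suc n) a}) = m (Suc n) div m n"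
proof -
  let ?B = "{b \<in> A. c (Suc n) b = c (Suc n) a}"
  have "{a' \<in> ?B. c n a' = c n b} = {a' \<in> A. c n a' = c n b}" if "b \<in> ?B" for b
    using that coarser[of _ b n] by auto
  moreover have "finite (c 0 ` ?B)"
    using card_class[OF assms, of "Suc n"] m_pos[of "Suc n"] by (simp add: card_ge_0_finite)
  ultimately have "m n * card (c n ` ?B) = card (c 0 ` ?B)"
    by (intro card_image_refine) (auto intro: coarser_le[of 0] card_class)
  then have "m n * card (c n ` ?B) = m (Suc n)" using card_class[OF assms] by simp
  then show ?thesis using m_pos[of n] by (metis nonzero_mult_div_cancel_left less_numeral_extra(3))
qed

end

definition digit_sequences :: "(nat \<Rightarrow> nat) \<Rightarrow> (nat \<Rightarrow> nat) set" where
  "digit_sequences q = {d. (\<forall>k. d k < q k) \<and> (\<exists>n. \<forall>k\<ge>n. d k = 0)}"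

text \<open>Number the subclasses of each class, giving 0 to the subclass of a base point.  The
  numbers met along the way from a point up to a class of the base point are the digits of that
  point.\<close>

lemma (in tower) digits_exist:
  obtains dig where "\<And>n a b. a \<in> A \<Longrightarrow> b \<in> A \<Longrightarrow> c n a = c n b \<longleftrightarrow> (\<forall>k\<ge>n. dig a k = dig b k)"
    and "dig ` A = digit_sequences (\<lambda>k. m (Suc k) div m k)"
proof -
  let ?q = "\<lambda>k. m (Suc k) div m k"
  obtain a\<^sub>0 where base_in: "a\<^sub>0 \<in> A" using nonempty by blast
  define sub where "sub n l = c n ` {b \<in> A. c (Suc n) b = l}" for n l
  have "\<exists>\<beta>. bij_betw \<beta> (sub n l) {..<?q n} \<and> (l = c (Suc n) a\<^sub>0 \<longrightarrow> \<beta> (c n a\<^sub>0) = 0)"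
    if l: "l \<in> c (Suc n) ` A" for n l
  proof -
    have "card (sub n l) = ?q n" "sub n l \<noteq> {}" using l card_subclasses by (auto simp: sub_def)
    moreover have "finite (sub n l)"
    proof -
      obtain a where a: "a \<in> A" "l = c (Suc n) a" using l by blast
      have "finite (c 0 ` {b \<in> A. c (Suc n) b = l})"
        using card_class[OF a(1), of "Suc n"] m_pos[of "Suc n"] a(2) by (simp add: card_ge_0_finite)
      then show ?thesis
        unfolding sub_def by (rule finite_image_refine) (auto intro: coarser_le[of 0 n])
    qed
    ultimately obtain \<gamma> where \<gamma>: "bij_betw \<gamma> (sub n l) {..<?q n}" "0 < ?q n"
      using ex_bij_betw_finite_nat[of "sub n l"] by (metis atLeast0LessThan card_gt_0_iff)
    show ?thesis
    proof (cases "l = c (Suc n) a\<^sub>0")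
      case True
      then have mem: "c n a\<^sub>0 \<in> sub n l" using base_in by (auto simp: sub_def)
      then have "\<gamma> (c n a\<^sub>0) \<in> {..<?q n}" using \<gamma>(1) by (auto simp: bij_betw_def)
      \<comment> \<open>A swap makes the base point's subclass number 0.\<close>
      then have "bij_betw (Transposition.transpose (\<gamma> (c n a\<^sub>0)) 0 \<circ> \<gamma>) (sub n l) {..<?q n}"
        using \<gamma> by (intro bij_betw_trans[OF \<gamma>(1)])
          (auto intro!: bij_betw_byWitness[where f' = "Transposition.transpose (\<gamma> (c n a\<^sub>0)) 0"]
            simp: Transposition.transpose_def)
      then show ?thesis by (intro exI[of _ "Transposition.transpose (\<gamma> (c n a\<^sub>0)) 0 \<circ> \<gamma>"]) auto
    qed (use \<gamma> in blast)
  qed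
  note numbering = this
  define \<beta> where "\<beta> n l = (SOME \<gamma>. bij_betw \<gamma> (sub n l) {..<?q n} \<and>
    (l = c (Suc n) a\<^sub>0 \<longrightarrow> \<gamma> (c n a\<^sub>0) = 0))" for n l
  have "bij_betw (\<beta> n l) (sub n l) {..<?q n} \<and> (l = c (Suc n) a\<^sub>0 \<longrightarrow> \<beta> n l (c n a\<^sub>0) = 0)"
    if "l \<in> c (Suc n) ` A" for n l
    unfolding \<beta>_def by (rule someI_ex[OF numbering[OF that]])
  then have \<beta>: "\<And>n l. l \<in> c (Suc n) ` A \<Longrightarrow> bij_betw (\<beta> n l) (sub n l) {..<?q n}"
    "\<And>n. \<beta> n (c (Suc n) a\<^sub>0) (c n a\<^sub>0) = 0"
    using base_in by auto
  define dig where "dig a n = \<beta> n (c (Suc n) a) (c n a)" for a n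
  have mem: "c n a \<in> sub n (c (Suc n) a)" if "a \<in> A" for a n
    using that by (auto simp: sub_def)
  have same_digit: "c n a = c n b" if "a \<in> A" "b \<in> A" "c (Suc n) a = c (Suc n) b" "dig a n = dig b n" for a b n
    using bij_betw_imp_inj_on[OF \<beta>(1)[of "c (Suc n) a" n]] mem[of a n] mem[of b n] that
    by (auto simp: dig_def dest: inj_onD)
  have down: "c n a = c n b" if "a \<in> A" "b \<in> A" "n \<le> N" "c N a = c N b" "\<forall>k\<ge>n. dig a k = dig b k" for a b n N
    using that(3)
  proof (induction rule: inc_induct)
    case base
    show ?case by (rule that(4))
  next
    case (step n')
    show ?case
      by (rule same_digit[OF that(1,2) step.IH]) (use that(5) step.hyps in simp)
  qed
  have iff: "c n a = c n b \<longleftrightarrow> (\<forall>k\<ge>n. dig a k = dig b k)" if ab: "a \<in> A" "b \<in> A" for n a b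
  proof
    assume "c n a = c n b"
    then have "c k a = c k b" if "k \<ge> n" for k
      using coarser_le[OF that \<open>a \<in> A\<close> \<open>b \<in> A\<close>] by simp
    then show "\<forall>k\<ge>n. dig a k = dig b k" by (auto simp: dig_def)
  next
    assume R: "\<forall>k\<ge>n. dig a k = dig b k"
    obtain N where "c N a = c N b" using exhausting[OF ab] by blast
    then have "c (max n N) a = c (max n N) b" using coarser_le[OF _ ab, of N "max n N"] by simp
    then show "c n a = c n b" using down[OF ab, of n "max n N"] R by simp
  qed
  have dig_base: "dig a\<^sub>0 k = 0" for k using \<beta>(2) by (simp add: dig_def)
  have "dig a \<in> digit_sequences ?q" if a: "a \<in> A" for a
  proof -
    obtain n where "c n a = c n a\<^sub>0" using exhausting[OF a base_in] by blast
    then have "\<forall>k\<ge>n. dig a k = 0" using iff[OF a base_in] dig_base by simp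
    moreover have "dig a k < ?q k" for k
      using bij_betwE[OF \<beta>(1)[of "c (Suc k) a" k]] mem[OF a, of k] a by (auto simp: dig_def)
    ultimately show ?thesis by (auto simp: digit_sequences_def)
  qed
  moreover have "\<exists>a\<in>A. dig a = d" if d: "d \<in> digit_sequences ?q" for d
  proof -
    obtain N where N: "\<forall>k\<ge>N. d k = 0" using d by (auto simp: digit_sequences_def)
    \<comment> \<open>The base point has the required digits from \<open>N\<close> on; the others are corrected downwards.\<close>
    have "\<exists>a\<in>A. \<forall>k\<ge>n. dig a k = d k" if "n \<le> N" for n
      using that
    proof (induction rule: inc_induct)
      case base
      then show ?case using base_in dig_base N by metis
    next
      case (step n)
      then obtain a where a: "a \<in> A" "\<forall>k\<ge>Suc n. dig a k = d k" by blast
      have "d n \<in> {..<?q n}" using d by (auto simp: digit_sequences_def)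
      then obtain z where z: "z \<in> sub n (c (Suc n) a)" "\<beta> n (c (Suc n) a) z = d n"
        using \<beta>(1)[of "c (Suc n) a" n] a(1) by (metis bij_betw_iff_bijections imageI)
      then obtain b where b: "b \<in> A" "c (Suc n) b = c (Suc n) a" "z = c n b" by (auto simp: sub_def)
      have "dig b n = d n" using z b by (simp add: dig_def)
      moreover have "\<forall>k\<ge>Suc n. dig b k = dig a k" using iff[OF b(1) a(1), of "Suc n"] b(2) by simp
      ultimately have "\<forall>k\<ge>n. dig b k = d k" using a(2) by (metis Suc_leI le_neq_implies_less)
      then show ?case using b(1) by blast
    qed
    from this[of 0] show ?thesis by auto
  qed
  ultimately have "dig ` A = digit_sequences ?q" by blast
  with iff show thesis by (rule that)
qed

text \<open>Only the counts \<open>m\<close> enter the set of digit sequences, so towers with equal counts can be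
  identified by matching digits.\<close>

lemma tower_map_exists:
  assumes "tower A c m" and "tower B d m" and inj: "inj_on (d 0) B"
  obtains \<theta> where "\<theta> ` A = B"
    and "\<And>n a b. a \<in> A \<Longrightarrow> b \<in> A \<Longrightarrow> d n (\<theta> a) = d n (\<theta> b) \<longleftrightarrow> c n a = c n b"
proof -
  let ?D = "digit_sequences (\<lambda>k. m (Suc k) div m k)"
  obtain f where f: "\<And>n a b. a \<in> A \<Longrightarrow> b \<in> A \<Longrightarrow> c n a = c n b \<longleftrightarrow> (\<forall>k\<ge>n. f a k = f b k)" "f ` A = ?D"
    using tower.digits_exist[OF assms(1)] by blast
  obtain g where g: "\<And>n a b. a \<in> B \<Longrightarrow> b \<in> B \<Longrightarrow> d n a = d n b \<longleftrightarrow> (\<forall>k\<ge>n. g a k = g b k)" "g ` B = ?D"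
    using tower.digits_exist[OF assms(2)] by blast
  have "inj_on g B"
  proof (rule inj_onI)
    fix a b assume "a \<in> B" "b \<in> B" "g a = g b"
    then show "a = b" using g(1)[of a b 0] inj by (auto dest: inj_onD)
  qed
  then have gB: "bij_betw g B ?D" using g(2) by (simp add: bij_betw_def)
  have bij: "bij_betw (inv_into B g) ?D B" by (rule bij_betw_inv_into[OF gB])
  have gi: "g (inv_into B g z) = z" if "z \<in> ?D" for z
    by (rule bij_betw_inv_into_right[OF gB that])
  show thesis
  proof
    show "(inv_into B g \<circ> f) ` A = B" using bij f(2) by (metis bij_betw_def image_comp)
    fix n a b assume ab: "a \<in> A" "b \<in> A"
    then have D: "f a \<in> ?D" "f b \<in> ?D" using f(2) by auto
    with bij have "inv_into B g (f a) \<in> B" "inv_into B g (f b) \<in> B" by (auto dest: bij_betwE)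
    then show "d n ((inv_into B g \<circ> f) a) = d n ((inv_into B g \<circ> f) b) \<longleftrightarrow> c n a = c n b"
      using g(1) f(1)[OF ab] gi D by simp
  qed
qed


section \<open>The component coordinate\<close>

locale bf_shift_homogeneous =
  fixes X :: "'a metric" and x\<^sub>0 :: 'a
  assumes bf: "boundedly_finite X" and sh: "shift_homogeneous X" and x0: "x\<^sub>0 \<in> mspace X"
begin

lemma hom: "homogeneous X" using sh by (rule shift_homogeneous_imp_homogeneous)

text \<open>The scales \<open>factorizing_step X + n\<close> suffice, being cofinal.  For an infinite factorizing step
  every \<open>K n y\<close> is the whole space, and the theorem is about a trivial group.\<close>

definition K :: "nat \<Rightarrow> 'a \<Rightarrow> 'a set" where
  "K n = scale_component X (factorizing_step X + ereal (real n))"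

lemma K_0: "K 0 = scale_component X (factorizing_step X)"
  by (simp add: K_def flip: zero_ereal_def)

lemma K_in: "z \<in> K n y \<Longrightarrow> z \<in> mspace X"
  unfolding K_def by (rule subsetD[OF scale_component_subset])

lemma K_self: "y \<in> mspace X \<Longrightarrow> y \<in> K n y"
  unfolding K_def by (rule scale_component_self)

lemma K_eq: "z \<in> K n y \<Longrightarrow> K n z = K n y"
  unfolding K_def by (rule scale_component_eq)

lemma K_mono: "n \<le> k \<Longrightarrow> K n y = K n z \<Longrightarrow> y \<in> mspace X \<Longrightarrow> K k y = K k z"
  unfolding K_def by (rule scale_component_eq_mono) (auto intro: add_left_mono)

lemma K_isometry:
  "self_isometry X f \<Longrightarrow> y \<in> mspace X \<Longrightarrow> z \<in> mspace X \<Longrightarrow> K n (f y) = K n (f z) \<longleftrightarrow> K n y = K n z"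
  unfolding K_def by (rule scale_component_isometry_eq_iff)

lemma K_close:
  assumes "y \<in> mspace X" "z \<in> mspace X" "mdist X y z \<le> real n" shows "K n y = K n z"
  unfolding K_def using assms le_factorizing_scale[of n X]
  by (intro scale_component_close) (auto intro: order_trans[of _ "ereal (real n)"])

lemma K_exhausting:
  assumes "y \<in> mspace X" "z \<in> mspace X" shows "\<exists>n. K n y = K n z"
  using K_close[OF assms] real_arch_simple by blast

text \<open>Finitely many pieces at every stage turn displacement bounds for single shift isometries into
  common bounds.\<close>

lemma finite_K_image: "finite (K n ` K k x\<^sub>0)"
proof (rule finite_image_refine)
  show "finite (K 0 ` K k x\<^sub>0)"
    using finite_factorizing_components_step[OF bf hom x0] by (simp add: K_0) (simp add: K_def)
  show "K n a = K n b" if "a \<in> K k x\<^sub>0" "b \<in> K k x\<^sub>0" "K 0 a = K 0 b" for a b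
    using that K_in by (intro K_mono[of 0 n]) auto
qed

definition rank :: "'a \<Rightarrow> nat" where
  "rank y = (LEAST n. K n y = K n x\<^sub>0)"

lemma K_x0_iff: 
  assumes "y \<in> mspace X" shows "K n y = K n x\<^sub>0 \<longleftrightarrow> rank y \<le> n"
proof
  show "K n y = K n x\<^sub>0 \<Longrightarrow> rank y \<le> n" unfolding rank_def by (rule Least_le)
  have "K (rank y) y = K (rank y) x\<^sub>0"
    unfolding rank_def using K_exhausting[OF assms x0] by (rule LeastI_ex)
  then show "rank y \<le> n \<Longrightarrow> K n y = K n x\<^sub>0" using K_mono assms by metis
qed

lemma rank_eq:
  assumes "y \<in> mspace X" "y' \<in> mspace X" "K k y = K k y'" "k < rank y"
  shows "rank y' = rank y"
proof -
  have "K n y = K n y'" if "k \<le> n" for n using K_mono[OF that assms(3,1)] .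
  then have "rank y \<le> n \<longleftrightarrow> rank y' \<le> n" if "k \<le> n" for n
    using that K_x0_iff[OF assms(1), of n] K_x0_iff[OF assms(2), of n] by simp
  from this[of "rank y"] this[of "rank y'"] this[of k] assms(4) show ?thesis by linarith
qed

definition pull :: "'a \<Rightarrow> 'a \<Rightarrow> 'a" where
  "pull z = (SOME f. self_isometry X f \<and> f z = x\<^sub>0 \<and>
    (\<forall>\<epsilon> u. \<epsilon> \<noteq> \<infinity> \<longrightarrow> 0 \<le> \<epsilon> \<longrightarrow> (\<exists>L. \<forall>c\<in>scale_component X \<epsilon> u. mdist X (f c) c \<le> L)))"

lemma pull:
  assumes "z \<in> mspace X"
  shows "self_isometry X (pull z)" "pull z z = x\<^sub>0"
    "\<epsilon> \<noteq> \<infinity> \<Longrightarrow> 0 \<le> \<epsilon> \<Longrightarrow> \<exists>L. \<forall>c\<in>scale_component X \<epsilon> u. mdist X (pull z c) c \<le> L"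
proof -
  have "\<exists>f. self_isometry X f \<and> f z = x\<^sub>0 \<and>
    (\<forall>\<epsilon> u. \<epsilon> \<noteq> \<infinity> \<longrightarrow> 0 \<le> \<epsilon> \<longrightarrow> (\<exists>L. \<forall>c\<in>scale_component X \<epsilon> u. mdist X (f c) c \<le> L))"
    using shift_homogeneousE[OF sh assms x0] by metis
  from someI_ex[OF this, folded pull_def]
  show "self_isometry X (pull z)" "pull z z = x\<^sub>0"
    "\<epsilon> \<noteq> \<infinity> \<Longrightarrow> 0 \<le> \<epsilon> \<Longrightarrow> \<exists>L. \<forall>c\<in>scale_component X \<epsilon> u. mdist X (pull z c) c \<le> L"
    by blast+
qed

text \<open>A point outside the \<open>n\<close>-th component of the base point, but inside the next one, is carried
  into the \<open>n\<close>-th component of the base point.  The isometry that does this depends only on the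
  \<open>n\<close>-th component of the point, so that all points of this component move rigidly together.\<close>

definition retract :: "'a \<Rightarrow> 'a" where
  "retract y = (case rank y of 0 \<Rightarrow> y | Suc n \<Rightarrow> pull (SOME z. z \<in> K n y) y)"

lemma rep_K:
  assumes "y \<in> mspace X"
  shows "(SOME z. z \<in> K n y) \<in> mspace X" "K n (SOME z. z \<in> K n y) = K n y"
proof -
  have "(SOME z. z \<in> K n y) \<in> K n y"
    by (rule someI[of _ y]) (rule K_self[OF assms])
  then show "(SOME z. z \<in> K n y) \<in> mspace X" "K n (SOME z. z \<in> K n y) = K n y"
    by (rule K_in, rule K_eq)
qed

lemma retract_in: "y \<in> mspace X \<Longrightarrow> retract y \<in> mspace X"
  using self_isometry_in[OF pull(1)[OF rep_K(1)]] by (simp add: retract_def split: nat.split)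

lemma rank_retract:
  assumes y: "y \<in> mspace X" shows "rank (retract y) \<le> rank y - 1"
proof (cases "rank y")
  case (Suc n)
  let ?z = "SOME z. z \<in> K n y"
  have "K n (pull ?z y) = K n (pull ?z ?z)"
    using K_isometry[OF pull(1)[OF rep_K(1)] y rep_K(1)] y rep_K(2) by simp
  then have "K n (retract y) = K n x\<^sub>0" using pull(2)[OF rep_K(1)] y Suc by (simp add: retract_def)
  then show ?thesis using K_x0_iff retract_in y Suc by simp
qed (simp add: retract_def)

lemma retract_isometry:
  assumes y: "y \<in> mspace X" and k: "k < rank y"
  obtains f where "self_isometry X f"
    "\<And>y'. y' \<in> mspace X \<Longrightarrow> K k y' = K k y \<Longrightarrow> retract y' = f y'"
proof -
  define n where "n = rank y - 1"
  have n: "rank y = Suc n" "k \<le> n" using k by (simp_all add: n_def)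
  let ?f = "pull (SOME z. z \<in> K n y)"
  have "retract y' = ?f y'" if y': "y' \<in> mspace X" "K k y' = K k y" for y'
  proof -
    have "rank y' = Suc n" using rank_eq[OF y y'(1) _ k] n(1) y'(2) by simp
    moreover have "K n y' = K n y" using K_mono[OF n(2) y'(2,1)] .
    ultimately show ?thesis by (simp add: retract_def)
  qed
  then show thesis by (intro that[of ?f] pull(1) rep_K(1) y)
qed

text \<open>Every retraction step lowers the rank, so as many steps as the rank arrive at the component
  \<open>K 0 x\<^sub>0\<close>.\<close>

definition core :: "'a \<Rightarrow> 'a" where
  "core y = (retract ^^ rank y) y"

lemma retract_power:
  assumes "y \<in> mspace X"
  shows "(retract ^^ k) y \<in> mspace X \<and> rank ((retract ^^ k) y) \<le> rank y - k"
proof (induction k)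
  case (Suc k)
  then show ?case using rank_retract[of "(retract ^^ k) y"] retract_in by fastforce
qed (use assms in simp)

lemma core_in: "y \<in> mspace X \<Longrightarrow> core y \<in> mspace X"
  and rank_core: "y \<in> mspace X \<Longrightarrow> rank (core y) = 0"
  using retract_power[of y "rank y"] by (auto simp: core_def)

lemma core_mem: "y \<in> mspace X \<Longrightarrow> core y \<in> K 0 x\<^sub>0"
  using K_x0_iff[OF core_in, of y 0] rank_core K_self[OF core_in] by blast

lemma core_rank_0: "rank y = 0 \<Longrightarrow> core y = y"
  by (simp add: core_def)

lemma core_retract:
  assumes y: "y \<in> mspace X" shows "core (retract y) = core y"
proof (cases "rank y")
  case (Suc n)
  have "(retract ^^ j) (core z) = core z" if "z \<in> mspace X" for j z
    using rank_core[OF that] by (induction j) (auto simp: retract_def)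
  then have *: "(retract ^^ (j + rank z)) z = core z" if "z \<in> mspace X" for j z
    using that by (simp add: funpow_add core_def)
  have "core y = (retract ^^ n) (retract y)" using Suc by (simp add: core_def funpow_swap1)
  also have "\<dots> = core (retract y)"
    using *[OF retract_in[OF y], of "n - rank (retract y)"] rank_retract[OF y] Suc by simp
  finally show ?thesis by simp
qed (simp add: retract_def)

text \<open>Two points with a common \<open>k\<close>-th component undergo the same isometries until this component
  has become that of the base point.  Whatever happens later therefore happens inside
  \<open>K k x\<^sub>0\<close>, whichever component the points came from.\<close>

lemma core_local_isometry:
  assumes "y \<in> mspace X" "y' \<in> mspace X" "K k y = K k y'"
  obtains z z' where "z \<in> mspace X" "z' \<in> mspace X" "rank z \<le> k" "rank z' \<le> k"
    "mdist X z z' = mdist X y y'" "core z = core y" "core z' = core y'"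
  using assms
proof (induction "rank y" arbitrary: y y' thesis rule: less_induct)
  case less
  show ?case
  proof (cases "rank y \<le> k")
    case True
    then have "rank y' \<le> k" using K_x0_iff less.prems by metis
    with True show ?thesis using less.prems by blast
  next
    case False
    then obtain f where f: "self_isometry X f"
      "\<And>u. u \<in> mspace X \<Longrightarrow> K k u = K k y \<Longrightarrow> retract u = f u"
      using retract_isometry[OF less.prems(2), of k] by auto
    have r: "retract y = f y" "retract y' = f y'" using f(2) less.prems by auto
    have K: "K k (retract y) = K k (retract y')"
      unfolding r using K_isometry[OF f(1)] less.prems by blast
    have rank: "rank (retract y) < rank y" using rank_retract[OF less.prems(2)] False by linarith
    obtain z z' where "z \<in> mspace X" "z' \<in> mspace X" "rank z \<le> k" "rank z' \<le> k"
      "mdist X z z' = mdist X (retract y) (retract y')" "core z = core (retract y)"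
      "core z' = core (retract y')"
      using less.hyps[OF rank _ retract_in retract_in K] less.prems(2,3) by blast
    moreover have "mdist X (retract y) (retract y') = mdist X y y'"
      unfolding r by (rule self_isometry_dist[OF f(1) less.prems(2,3)])
    ultimately show ?thesis using less.prems(1) core_retract less.prems(2,3) by simp
  qed
qed

text \<open>This is where the isometries have to be shifts.  For an infinite factorizing step, where
  components are not large scale connected in general, all ranks vanish.\<close>

lemma retract_displacement:
  "\<exists>L. \<forall>y\<in>mspace X. rank y = Suc k \<longrightarrow> mdist X (retract y) y \<le> L"
proof (cases "factorizing_step X = \<infinity>")
  case True
  then have "rank y = 0" if "y \<in> mspace X" for y
    using that x0 K_x0_iff[OF that, of 0] by (simp add: K_0 True scale_component_infinity)
  then show ?thesis by auto
next
  case False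
  then have e: "factorizing_step X + ereal (real k) \<noteq> \<infinity>" "0 \<le> factorizing_step X + ereal (real k)"
    using factorizing_step_nonneg[of X] by auto
  have "\<exists>L. \<forall>c\<in>C. mdist X (pull (SOME z. z \<in> C) c) c \<le> L" if "C \<in> K k ` K (Suc k) x\<^sub>0" for C
  proof -
    from that obtain u where u: "u \<in> mspace X" "C = K k u"
      using K_in by blast
    then show ?thesis using pull(3)[OF rep_K(1)[OF u(1), of k] e, of u] by (simp add: K_def)
  qed
  then obtain L where L: "\<And>C c. C \<in> K k ` K (Suc k) x\<^sub>0 \<Longrightarrow> c \<in> C \<Longrightarrow>
      mdist X (pull (SOME z. z \<in> C) c) c \<le> L C"
    by metis
  have "mdist X (retract y) y \<le> Max (L ` K k ` K (Suc k) x\<^sub>0)" if y: "y \<in> mspace X" "rank y = Suc k" for y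
  proof -
    have "K (Suc k) y = K (Suc k) x\<^sub>0" using K_x0_iff[OF y(1)] y(2) by simp
    then have "K k y \<in> K k ` K (Suc k) x\<^sub>0" using K_self[OF y(1)] by blast
    moreover from this have "mdist X (retract y) y \<le> L (K k y)"
      using L[of "K k y" y] K_self[OF y(1)] y(2) by (simp add: retract_def)
    ultimately show ?thesis using finite_K_image[of k "Suc k"]
      by (meson Max_ge finite_imageI imageI order_trans)
  qed
  then show ?thesis by blast
qed

lemma core_displacement:
  "\<exists>L. \<forall>y\<in>mspace X. rank y \<le> k \<longrightarrow> mdist X (core y) y \<le> L"
proof (induction k)
  case 0
  have "mdist X (core y) y = 0" if "y \<in> mspace X" "rank y = 0" for y
    using that by (simp add: core_rank_0)
  then show ?case by (intro exI[of _ 0]) simp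
next
  case (Suc k)
  then obtain L where L: "\<And>y. y \<in> mspace X \<Longrightarrow> rank y \<le> k \<Longrightarrow> mdist X (core y) y \<le> L" by blast
  obtain M where M: "\<And>y. y \<in> mspace X \<Longrightarrow> rank y = Suc k \<Longrightarrow> mdist X (retract y) y \<le> M"
    using retract_displacement[of k] by blast
  have "mdist X (core y) y \<le> L + max M 0" if y: "y \<in> mspace X" "rank y \<le> Suc k" for y
  proof (cases "rank y \<le> k")
    case True
    then show ?thesis using L[OF y(1)] by linarith
  next
    case False
    then have r: "rank y = Suc k" using y(2) by simp
    then have "mdist X (core (retract y)) (retract y) \<le> L"
      using L[OF retract_in[OF y(1)]] rank_retract[OF y(1)] by simp
    then have "mdist X (core y) (retract y) \<le> L" using core_retract[OF y(1)] by simp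
    with M[OF y(1) r] mdist_triangle[OF core_in[OF y(1)] retract_in[OF y(1)] y(1)]
    show ?thesis by linarith
  qed
  then show ?case by blast
qed

text \<open>The bound depends on the scale but not on the component: by the two preceding results it is
  twice a bound for the displacement of \<open>core\<close> on \<open>K k x\<^sub>0\<close>.\<close>

lemma core_almost_isometry:
  "\<exists>L. \<forall>y\<in>mspace X. \<forall>y'\<in>mspace X. K k y = K k y' \<longrightarrow>
     \<bar>mdist X (core y) (core y') - mdist X y y'\<bar> \<le> L"
proof -
  obtain L where L: "\<And>y. y \<in> mspace X \<Longrightarrow> rank y \<le> k \<Longrightarrow> mdist X (core y) y \<le> L"
    using core_displacement[of k] by blast
  have "\<bar>mdist X (core y) (core y') - mdist X y y'\<bar> \<le> 2 * L"
    if y: "y \<in> mspace X" "y' \<in> mspace X" "K k y = K k y'" for y y'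
  proof -
    obtain z z' where z: "z \<in> mspace X" "z' \<in> mspace X" "rank z \<le> k" "rank z' \<le> k"
      "mdist X z z' = mdist X y y'" "core z = core y" "core z' = core y'"
      using core_local_isometry[OF y] by blast
    note c = core_in[OF z(1)] core_in[OF z(2)]
    have "mdist X (core z) (core z') \<le> mdist X (core z) z + mdist X z (core z')"
      "mdist X z (core z') \<le> mdist X z z' + mdist X z' (core z')"
      "mdist X z z' \<le> mdist X z (core z) + mdist X (core z) z'"
      "mdist X (core z) z' \<le> mdist X (core z) (core z') + mdist X (core z') z'"
      using z(1,2) c by (auto intro: mdist_triangle)
    with L[OF z(1,3)] L[OF z(2,4)] show ?thesis
      unfolding z(5-7)[symmetric] using mdist_commute[of X z "core z"] mdist_commute[of X z' "core z'"]
      by linarith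
  qed
  then show ?thesis by blast
qed

lemma core_inj_on_component:
  assumes "y \<in> mspace X" "y' \<in> mspace X" "K 0 y = K 0 y'" "core y = core y'"
  shows "y = y'"
proof -
  obtain z z' where "z \<in> mspace X" "z' \<in> mspace X" "rank z \<le> 0" "rank z' \<le> 0"
      "mdist X z z' = mdist X y y'" "core z = core y" "core z' = core y'"
    using core_local_isometry[OF assms(1-3)] by blast
  moreover from this have "z = z'" using core_rank_0[of z] core_rank_0[of z'] assms(4) by simp
  ultimately have "mdist X y y' = 0" by (metis mdist_zero)
  then show ?thesis using assms by simp
qed

lemma core_surj_on_component:
  assumes "y \<in> mspace X" "w \<in> K 0 x\<^sub>0"
  shows "\<exists>y'\<in>mspace X. K 0 y' = K 0 y \<and> core y' = w"
  using assms(1)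
proof (induction "rank y" arbitrary: y rule: less_induct)
  case less
  show ?case
  proof (cases "rank y = 0")
    case True
    have w: "w \<in> mspace X" "K 0 w = K 0 x\<^sub>0"
      using K_in[OF assms(2)] K_eq[OF assms(2)] .
    then have "core w = w" using K_x0_iff[of w 0] by (intro core_rank_0) simp
    then show ?thesis using w True K_x0_iff[OF less.prems, of 0] by auto
  next
    case False
    have "rank (retract y) < rank y" using rank_retract[OF less.prems] False by linarith
    from less.hyps[OF this retract_in[OF less.prems]]
    obtain u where u: "u \<in> mspace X" "K 0 u = K 0 (retract y)" "core u = w" by blast
    obtain f where f: "self_isometry X f"
      "\<And>y'. y' \<in> mspace X \<Longrightarrow> K 0 y' = K 0 y \<Longrightarrow> retract y' = f y'"
      using retract_isometry[OF less.prems, of 0] False by auto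
    obtain v where v: "v \<in> mspace X" "u = f v"
      using f(1) u(1) unfolding self_isometry_def bij_betw_def by blast
    have "K 0 (f v) = K 0 (f y)" using u(2) f(2)[OF less.prems] v(2) by simp
    then have "K 0 v = K 0 y" using K_isometry[OF f(1) v(1) less.prems] by blast
    moreover from this have "core v = w" using core_retract[OF v(1)] f(2)[OF v(1)] v(2) u(3) by simp
    ultimately show ?thesis using v(1) by blast
  qed
qed

end


section \<open>Balls of a proper left-invariant metric on a countable group\<close>

text \<open>By Baire's theorem a countable locally compact metric space has an isolated point; left
  translations then isolate every point, so that compact sets are finite.\<close>

lemma proper_left_invariant_finite_ball:
  fixes G (structure)
  assumes G: "group G" and cnt: "countable (carrier G)"
    and \<rho>: "proper_left_invariant_metric G \<rho>" and a: "a \<in> carrier G"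
  shows "finite {b \<in> carrier G. mdist \<rho> a b \<le> R}"
proof -
  interpret group G by (rule G)
  interpret M: Metric_space "carrier G" "mdist \<rho>"
    using \<rho> Metric_space_mspace_mdist[of \<rho>] by (simp add: proper_left_invariant_metric_def)
  have inv: "mdist \<rho> (g \<otimes> x) (g \<otimes> y) = mdist \<rho> x y"
    if "g \<in> carrier G" "x \<in> carrier G" "y \<in> carrier G" for g x y
    using \<rho> that by (simp add: proper_left_invariant_metric_def)
  have proper: "compactin M.mtopology (M.mcball x r)" for x r
  proof -
    have "mspace \<rho> = carrier G" using \<rho> by (simp add: proper_left_invariant_metric_def)
    then have "\<forall>B. closedin M.mtopology B \<and> M.mbounded B \<longrightarrow> compactin M.mtopology B"
      using \<rho> by (simp add: proper_left_invariant_metric_def proper_metric_def mtopology_of_def)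
    then show ?thesis using M.mbounded_mcball M.closedin_mcball by blast
  qed
  have "locally_compact_space M.mtopology"
    unfolding locally_compact_space_def
    using proper M.openin_mball M.mball_subset_mcball M.centre_in_mball_iff zero_less_one
    by (metis M.topspace_mtopology)
  then have "\<exists>x\<in>carrier G. M.mtopology interior_of {x} \<noteq> {}"
    using Baire_category_alt[of M.mtopology "(\<lambda>x. {x}) ` carrier G"] cnt
      metrizable_imp_regular_space[OF M.metrizable_space_mtopology] closedin_Hausdorff_singleton[OF M.Hausdorff_space_mtopology]
      interior_of_topspace[of M.mtopology] one_closed by auto
  then obtain x where x: "x \<in> carrier G" "M.mtopology interior_of {x} \<noteq> {}" by blast
  then have "openin M.mtopology {x}"
    using interior_of_subset[of M.mtopology "{x}"] openin_interior_of[of M.mtopology "{x}"]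
    by (metis subset_singletonD)
  then obtain r where r: "r > 0" "M.mball x r \<subseteq> {x}"
    by (auto simp: M.openin_mtopology)
  have iso: "openin M.mtopology {y}" if y: "y \<in> carrier G" for y
  proof -
    have "z = y" if z: "z \<in> M.mball y r" for z
    proof -
      from z have zc: "z \<in> carrier G" and lt: "mdist \<rho> y z < r" by auto
      define k where "k = x \<otimes> inv y"
      have k: "k \<in> carrier G" "k \<otimes> y = x"
        using x(1) y by (auto simp: k_def m_assoc)
      have "k \<otimes> z \<in> M.mball x r"
        using inv[OF k(1) y zc] k lt zc x(1) by simp
      then have "k \<otimes> z = k \<otimes> y" using r(2) k(2) by auto
      then show "z = y" using k(1) zc y by simp
    qed
    then show ?thesis using r(1) y by (auto simp: M.openin_mtopology intro!: exI[of _ r])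
  qed
  have "\<forall>U\<in>(\<lambda>y. {y}) ` M.mcball a R. openin M.mtopology U"
    using iso by auto
  moreover have "M.mcball a R \<subseteq> \<Union> ((\<lambda>y. {y}) ` M.mcball a R)" by auto
  ultimately obtain \<F> where \<F>: "finite \<F>" "\<F> \<subseteq> (\<lambda>y. {y}) ` M.mcball a R" "M.mcball a R \<subseteq> \<Union> \<F>"
    using proper[of a R] unfolding compactin_def by meson
  have "finite (\<Union> \<F>)" using \<F>(1,2) by auto
  then have "finite (M.mcball a R)" using \<F>(3) by (rule finite_subset[rotated])
  moreover have "{b \<in> carrier G. mdist \<rho> a b \<le> R} = M.mcball a R" using a by auto
  ultimately show ?thesis by simp
qed


section \<open>The tower of finite subgroups of a direct sum of cyclic groups\<close>

text \<open>A direct sum of direct sums is handled as a single direct sum over pairs of indices.\<close>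

definition Z_index :: "(nat \<Rightarrow> enat) \<Rightarrow> (nat \<times> nat) set" where
  "Z_index \<phi> = {(p, j). prime p \<and> enat j < \<phi> p}"

lemma group_cyclic_power: "group (cyclic_power p n)"
  unfolding cyclic_power_def by (intro sum_group group_integer_mod_group)

lemma group_Z_group: "group (Z_group \<phi>)"
  unfolding Z_group_def by (intro sum_group group_cyclic_power)

lemma carrier_cyclic_power:
  assumes "prime p"
  shows "g \<in> carrier (cyclic_power p n) \<longleftrightarrow>
    (\<forall>j. \<not> enat j < n \<longrightarrow> g j = undefined) \<and> (\<forall>j. enat j < n \<longrightarrow> 0 \<le> g j \<and> g j < int p) \<and>
    finite {j. enat j < n \<and> g j \<noteq> 0}"
  unfolding cyclic_power_def
  by (subst carrier_sum_group)
    (use assms in \<open>auto simp: carrier_integer_mod_group PiE_iff extensional_def prime_gt_0_nat\<close>)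

lemma carrier_Z_group:
  "g \<in> carrier (Z_group \<phi>) \<longleftrightarrow>
    (\<forall>p. \<not> prime p \<longrightarrow> g p = undefined) \<and>
    (\<forall>p j. prime p \<longrightarrow> \<not> enat j < \<phi> p \<longrightarrow> g p j = undefined) \<and>
    (\<forall>p j. (p, j) \<in> Z_index \<phi> \<longrightarrow> 0 \<le> g p j \<and> g p j < int p) \<and>
    finite {(p, j) \<in> Z_index \<phi>. g p j \<noteq> 0}" (is "_ \<longleftrightarrow> ?A \<and> ?B \<and> ?C \<and> finite ?F")
proof -
  have "g \<in> carrier (Z_group \<phi>) \<longleftrightarrow> ?A \<and> (\<forall>p. prime p \<longrightarrow> g p \<in> carrier (cyclic_power p (\<phi> p))) \<and>
    finite {p. prime p \<and> g p \<noteq> \<one>\<^bsub>cyclic_power p (\<phi> p)\<^esub>}"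
    unfolding Z_group_def
    by (subst carrier_sum_group) (auto simp: group_cyclic_power PiE_iff extensional_def)
  also have "\<dots> \<longleftrightarrow> ?A \<and> ?B \<and> ?C \<and> (\<forall>p. prime p \<longrightarrow> finite {j. enat j < \<phi> p \<and> g p j \<noteq> 0}) \<and>
    finite {p. prime p \<and> g p \<noteq> \<one>\<^bsub>cyclic_power p (\<phi> p)\<^esub>}"
    by (auto simp: carrier_cyclic_power Z_index_def)
  also have "\<dots> \<longleftrightarrow> ?A \<and> ?B \<and> ?C \<and> finite ?F"
  proof (intro conj_cong refl)
    assume B: ?B
    have one: "g p \<noteq> \<one>\<^bsub>cyclic_power p (\<phi> p)\<^esub> \<longleftrightarrow> (\<exists>j. enat j < \<phi> p \<and> g p j \<noteq> 0)" if "prime p" for p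
      using B that by (auto simp: cyclic_power_def fun_eq_iff)
    have F: "?F = (SIGMA p:{p. prime p \<and> g p \<noteq> \<one>\<^bsub>cyclic_power p (\<phi> p)\<^esub>}. {j. enat j < \<phi> p \<and> g p j \<noteq> 0})"
      using one by (auto simp: Z_index_def)
    show "(\<forall>p. prime p \<longrightarrow> finite {j. enat j < \<phi> p \<and> g p j \<noteq> 0}) \<and>
      finite {p. prime p \<and> g p \<noteq> \<one>\<^bsub>cyclic_power p (\<phi> p)\<^esub>} \<longleftrightarrow> finite ?F" (is "?L \<longleftrightarrow> _")
    proof
      assume ?L
      then show "finite ?F" unfolding F by (intro finite_SigmaI) auto
    next
      assume fin: "finite ?F"
      have "{j. enat j < \<phi> p \<and> g p j \<noteq> 0} \<subseteq> snd ` ?F" if "prime p" for p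
      proof
        fix j assume "j \<in> {j. enat j < \<phi> p \<and> g p j \<noteq> 0}"
        with that have "(p, j) \<in> ?F" by (simp add: Z_index_def)
        then show "j \<in> snd ` ?F" by (rule image_eqI[rotated]) simp
      qed
      moreover have "{p. prime p \<and> g p \<noteq> \<one>\<^bsub>cyclic_power p (\<phi> p)\<^esub>} \<subseteq> fst ` ?F"
      proof
        fix p assume "p \<in> {p. prime p \<and> g p \<noteq> \<one>\<^bsub>cyclic_power p (\<phi> p)\<^esub>}"
        then obtain j where "prime p" "enat j < \<phi> p" "g p j \<noteq> 0" using one[of p] by blast
        then have "(p, j) \<in> ?F" by (simp add: Z_index_def)
        then show "p \<in> fst ` ?F" by (rule image_eqI[rotated]) simp
      qed
      ultimately show ?L using fin by (meson finite_imageI finite_subset)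
    qed
  qed
  finally show ?thesis .
qed

lemma Z_group_eqI:
  assumes "g \<in> carrier (Z_group \<phi>)" "h \<in> carrier (Z_group \<phi>)"
    "\<And>p j. (p, j) \<in> Z_index \<phi> \<Longrightarrow> g p j = h p j"
  shows "g = h"
proof (intro ext)
  fix p j
  show "g p j = h p j"
    using assms(1,2)[unfolded carrier_Z_group] assms(3)[of p j] by (cases "prime p"; cases "enat j < \<phi> p") (auto simp: Z_index_def)
qed

lemma one_Z_group: "(p, j) \<in> Z_index \<phi> \<Longrightarrow> \<one>\<^bsub>Z_group \<phi>\<^esub> p j = 0"
  by (simp add: Z_index_def Z_group_def cyclic_power_def)

lemma mult_Z_group:
  "(p, j) \<in> Z_index \<phi> \<Longrightarrow> (g \<otimes>\<^bsub>Z_group \<phi>\<^esub> h) p j = (g p j + h p j) mod int p"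
  by (simp add: Z_index_def Z_group_def cyclic_power_def)

text \<open>The subgroup of elements supported on the first \<open>multiplicity p m\<close> copies of \<open>\<int>/p\<int>\<close>, for each
  \<open>p\<close>, has order \<open>m\<close>; an element's coset is represented by its remaining coordinates.\<close>

definition Z_coset :: "(nat \<Rightarrow> enat) \<Rightarrow> nat \<Rightarrow> (nat \<Rightarrow> nat \<Rightarrow> int) \<Rightarrow> nat \<times> nat \<Rightarrow> int" where
  "Z_coset \<phi> m g = (\<lambda>(p, j). if (p, j) \<in> Z_index \<phi> \<and> multiplicity p m \<le> j then g p j else 0)"

lemma Z_coset_eq_iff:
  "Z_coset \<phi> m g = Z_coset \<phi> m h \<longleftrightarrow>
    (\<forall>p j. (p, j) \<in> Z_index \<phi> \<longrightarrow> multiplicity p m \<le> j \<longrightarrow> g p j = h p j)"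
  by (auto simp: Z_coset_def fun_eq_iff)

lemma Z_coset_left_mult:
  "Z_coset \<phi> m g = Z_coset \<phi> m h \<Longrightarrow>
    Z_coset \<phi> m (k \<otimes>\<^bsub>Z_group \<phi>\<^esub> g) = Z_coset \<phi> m (k \<otimes>\<^bsub>Z_group \<phi>\<^esub> h)"
  by (simp add: Z_coset_eq_iff mult_Z_group)

lemma Z_coset_left_mult_iff:
  assumes "g \<in> carrier (Z_group \<phi>)" "h \<in> carrier (Z_group \<phi>)" "k \<in> carrier (Z_group \<phi>)"
  shows "Z_coset \<phi> m (k \<otimes>\<^bsub>Z_group \<phi>\<^esub> g) = Z_coset \<phi> m (k \<otimes>\<^bsub>Z_group \<phi>\<^esub> h)
    \<longleftrightarrow> Z_coset \<phi> m g = Z_coset \<phi> m h"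
proof -
  interpret group "Z_group \<phi>" by (rule group_Z_group)
  show ?thesis
    using Z_coset_left_mult[of \<phi> m "k \<otimes>\<^bsub>Z_group \<phi>\<^esub> g" "k \<otimes>\<^bsub>Z_group \<phi>\<^esub> h" "inv\<^bsub>Z_group \<phi>\<^esub> k"]
      Z_coset_left_mult[of \<phi> m g h k] assms by (auto simp: m_assoc[symmetric])
qed

lemma inj_on_Z_coset_1: "inj_on (Z_coset \<phi> 1) (carrier (Z_group \<phi>))"
  by (rule inj_onI) (auto intro: Z_group_eqI simp: Z_coset_eq_iff)

text \<open>The elements of the subgroup are the functions on the finite set of pairs \<open>(p, j)\<close> with
  \<open>j < multiplicity p m\<close> that take \<open>p\<close> values at \<open>(p, j)\<close>; their number is the prime factorization
  of \<open>m\<close>.\<close>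

lemma card_Z_coset_one:
  assumes m: "0 < m" and le: "\<And>p. prime p \<Longrightarrow> enat (multiplicity p m) \<le> \<phi> p"
  shows "card {g \<in> carrier (Z_group \<phi>). Z_coset \<phi> m g = Z_coset \<phi> m \<one>\<^bsub>Z_group \<phi>\<^esub>} = m"
proof -
  let ?H = "{g \<in> carrier (Z_group \<phi>). Z_coset \<phi> m g = Z_coset \<phi> m \<one>\<^bsub>Z_group \<phi>\<^esub>}"
  define B where "B = (SIGMA p:prime_factors m. {..<multiplicity p m})"
  have finB: "finite B" unfolding B_def by (intro finite_SigmaI) auto
  have B: "(p, j) \<in> B \<longleftrightarrow> (p, j) \<in> Z_index \<phi> \<and> j < multiplicity p m" for p j
  proof -
    have "enat j < \<phi> p" if "prime p" "j < multiplicity p m"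
      using le[OF that(1)] that(2) by (meson enat_ord_simps(2) less_le_trans)
    moreover have "p \<in> prime_factors m" if "prime p" "j < multiplicity p m"
      using that by (simp add: prime_factors_multiplicity)
    ultimately show ?thesis by (auto simp: B_def Z_index_def)
  qed
  define P where "P = PiE B (\<lambda>(p, j). {0..<int p})"
  define \<psi> where "\<psi> g = restrict (\<lambda>(p, j). g p j) B" for g :: "nat \<Rightarrow> nat \<Rightarrow> int"
  define \<xi> where "\<xi> u p = (if prime p
      then (\<lambda>j. if enat j < \<phi> p then (if (p, j) \<in> B then u (p, j) else 0) else undefined)
      else undefined)" for u :: "nat \<times> nat \<Rightarrow> int" and p
  have H: "g \<in> ?H \<longleftrightarrow> g \<in> carrier (Z_group \<phi>) \<and> (\<forall>p j. (p, j) \<in> Z_index \<phi> \<longrightarrow> (p, j) \<notin> B \<longrightarrow> g p j = 0)" for g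
    using one_Z_group[of _ _ \<phi>] by (auto simp: Z_coset_eq_iff B not_less)
  have \<xi>: "\<xi> u p j = (if (p, j) \<in> B then u (p, j) else 0)" if "(p, j) \<in> Z_index \<phi>" for u p j
    using that by (simp add: \<xi>_def Z_index_def)
  have \<xi>P: "\<xi> u \<in> ?H" if u: "u \<in> P" for u
  proof -
    have "0 \<le> u (p, j) \<and> u (p, j) < int p" if "(p, j) \<in> B" for p j
      using PiE_mem[OF u[unfolded P_def] that] by simp
    then have 1: "\<forall>p j. (p, j) \<in> Z_index \<phi> \<longrightarrow> 0 \<le> \<xi> u p j \<and> \<xi> u p j < int p"
      using \<xi> by (auto simp: Z_index_def prime_gt_0_nat)
    have "{(p, j) \<in> Z_index \<phi>. \<xi> u p j \<noteq> 0} \<subseteq> B" using \<xi> by (auto split: if_splits)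
    then have "finite {(p, j) \<in> Z_index \<phi>. \<xi> u p j \<noteq> 0}" using finB by (rule finite_subset)
    then have "\<xi> u \<in> carrier (Z_group \<phi>)"
      unfolding carrier_Z_group using 1 by (auto simp: \<xi>_def)
    then show ?thesis unfolding H using \<xi> by simp
  qed
  have "bij_betw \<psi> ?H P"
  proof (rule bij_betw_byWitness[where f' = \<xi>])
    show "\<xi> ` P \<subseteq> ?H" using \<xi>P by blast
    show "\<psi> ` ?H \<subseteq> P"
      using B unfolding P_def \<psi>_def by (auto simp: carrier_Z_group)
    show "\<forall>g\<in>?H. \<xi> (\<psi> g) = g"
    proof
      fix g assume g: "g \<in> ?H"
      then have "\<psi> g \<in> P" using \<open>\<psi> ` ?H \<subseteq> P\<close> by blast
      then have "\<xi> (\<psi> g) \<in> ?H" by (rule \<xi>P)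
      with g show "\<xi> (\<psi> g) = g"
        unfolding H by (intro Z_group_eqI[of _ \<phi>]) (auto simp: \<xi> \<psi>_def)
    qed
    show "\<forall>u\<in>P. \<psi> (\<xi> u) = u"
    proof
      fix u assume "u \<in> P"
      then have "u \<in> extensional B" by (simp add: P_def PiE_def)
      then show "\<psi> (\<xi> u) = u" using \<xi> B by (auto simp: \<psi>_def fun_eq_iff extensional_def)
    qed
  qed
  then have "card ?H = card P" by (rule bij_betw_same_card)
  also have "\<dots> = (\<Prod>(p, j)\<in>B. p)"
    unfolding P_def using finB by (subst card_PiE) (auto intro: prod.cong)
  also have "\<dots> = (\<Prod>p\<in>prime_factors m. p ^ multiplicity p m)"
    unfolding B_def by (subst prod.Sigma[symmetric]) auto
  also have "\<dots> = m" using prime_factorization_nat[OF m] by simp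
  finally show ?thesis .
qed

text \<open>The conditions say that the subgroups of orders \<open>m n\<close> form an increasing sequence from the
  trivial group that stays inside the group and exhausts it.\<close>

locale Z_tower =
  fixes \<phi> :: "nat \<Rightarrow> enat" and m :: "nat \<Rightarrow> nat"
  assumes m_pos: "0 < m n" and m_0: "m 0 = 1"
    and m_dvd: "n \<le> n' \<Longrightarrow> m n dvd m n'"
    and multiplicity_le: "prime p \<Longrightarrow> enat (multiplicity p (m n)) \<le> \<phi> p"
    and less_multiplicity: "prime p \<Longrightarrow> enat j < \<phi> p \<Longrightarrow> \<exists>n. j < multiplicity p (m n)"
begin

lemma Z_coset_mono:
  assumes "n \<le> n'" "Z_coset \<phi> (m n) g = Z_coset \<phi> (m n) h"
  shows "Z_coset \<phi> (m n') g = Z_coset \<phi> (m n') h"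
proof -
  have "multiplicity p (m n) \<le> multiplicity p (m n')" for p
    using m_dvd[OF assms(1)] m_pos[of n'] by (intro dvd_imp_multiplicity_le) auto
  then have "multiplicity p (m n) \<le> j" if "multiplicity p (m n') \<le> j" for p j
    using that order_trans by blast
  then show ?thesis using assms(2) by (simp add: Z_coset_eq_iff)
qed

lemma Z_coset_exhausting:
  assumes "g \<in> carrier (Z_group \<phi>)" "h \<in> carrier (Z_group \<phi>)"
  shows "\<exists>n. Z_coset \<phi> (m n) g = Z_coset \<phi> (m n) h"
proof -
  define F where "F = {(p, j) \<in> Z_index \<phi>. g p j \<noteq> 0} \<union> {(p, j) \<in> Z_index \<phi>. h p j \<noteq> 0}"
  have fin: "finite F" using assms by (simp add: F_def carrier_Z_group)
  have "\<forall>i\<in>F. \<exists>n. snd i < multiplicity (fst i) (m n)"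
    using less_multiplicity by (auto simp: F_def Z_index_def)
  then obtain N where N: "\<forall>i\<in>F. snd i < multiplicity (fst i) (m (N i))"
    by (rule bchoice[THEN exE])
  define n where "n = Max (insert 0 (N ` F))"
  have "j < multiplicity p (m n)" if "(p, j) \<in> F" for p j
  proof -
    have "N (p, j) \<le> n" unfolding n_def using fin that by (intro Max_ge) auto
    then have "multiplicity p (m (N (p, j))) \<le> multiplicity p (m n)"
      using m_dvd m_pos[of n] by (intro dvd_imp_multiplicity_le) auto
    with N that show ?thesis by fastforce
  qed
  then have "Z_coset \<phi> (m n) g = Z_coset \<phi> (m n) h"
    unfolding Z_coset_eq_iff F_def by fastforce
  then show ?thesis by blast
qed

lemma card_Z_coset:
  assumes "a \<in> carrier (Z_group \<phi>)"
  shows "card {b \<in> carrier (Z_group \<phi>). Z_coset \<phi> (m n) b = Z_coset \<phi> (m n) a} = m n"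
proof -
  interpret group "Z_group \<phi>" by (rule group_Z_group)
  let ?d = "Z_coset \<phi> (m n)" and ?G = "carrier (Z_group \<phi>)"
  have "bij_betw (\<lambda>b. a \<otimes>\<^bsub>Z_group \<phi>\<^esub> b) {b \<in> ?G. ?d b = ?d \<one>\<^bsub>Z_group \<phi>\<^esub>} {b \<in> ?G. ?d b = ?d a}"
  proof (rule bij_betw_byWitness[where f' = "\<lambda>b. inv\<^bsub>Z_group \<phi>\<^esub> a \<otimes>\<^bsub>Z_group \<phi>\<^esub> b"])
    show "(\<lambda>b. a \<otimes>\<^bsub>Z_group \<phi>\<^esub> b) ` {b \<in> ?G. ?d b = ?d \<one>\<^bsub>Z_group \<phi>\<^esub>} \<subseteq> {b \<in> ?G. ?d b = ?d a}"
      using assms Z_coset_left_mult[of \<phi> "m n" _ "\<one>\<^bsub>Z_group \<phi>\<^esub>" a] by auto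
    show "(\<lambda>b. inv\<^bsub>Z_group \<phi>\<^esub> a \<otimes>\<^bsub>Z_group \<phi>\<^esub> b) ` {b \<in> ?G. ?d b = ?d a} \<subseteq> {b \<in> ?G. ?d b = ?d \<one>\<^bsub>Z_group \<phi>\<^esub>}"
      using assms Z_coset_left_mult[of \<phi> "m n" _ a "inv\<^bsub>Z_group \<phi>\<^esub> a"] by auto
  qed (use assms in \<open>auto simp: m_assoc[symmetric]\<close>)
  from bij_betw_same_card[OF this] show ?thesis
    using card_Z_coset_one[of "m n" \<phi>, OF m_pos multiplicity_le] by simp
qed

lemma tower_Z_group: "tower (carrier (Z_group \<phi>)) (\<lambda>n. Z_coset \<phi> (m n)) m"
proof
  show "carrier (Z_group \<phi>) \<noteq> {}"
    using group.is_monoid[OF group_Z_group] monoid.one_closed by blast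
  show "card (Z_coset \<phi> (m 0) ` {b \<in> carrier (Z_group \<phi>). Z_coset \<phi> (m n) b = Z_coset \<phi> (m n) a}) = m n"
    if "a \<in> carrier (Z_group \<phi>)" for n a
    using card_Z_coset[OF that] inj_on_subset[OF inj_on_Z_coset_1]
    by (subst card_image) (auto simp: m_0)
qed (auto intro: Z_coset_exhausting m_pos Z_coset_mono[OF le_SucI[OF order_refl]])

lemma countable_Z_group: "countable (carrier (Z_group \<phi>))"
proof -
  interpret group "Z_group \<phi>" by (rule group_Z_group)
  let ?H = "\<lambda>n. {b \<in> carrier (Z_group \<phi>). Z_coset \<phi> (m n) b = Z_coset \<phi> (m n) \<one>\<^bsub>Z_group \<phi>\<^esub>}"
  have "finite (?H n)" for n
    using card_Z_coset[OF one_closed, of n] m_pos[of n] by (simp add: card_ge_0_finite)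
  then have "countable (\<Union>n. ?H n)" by (intro countable_UN countableI_type countable_finite)
  moreover have "carrier (Z_group \<phi>) = (\<Union>n. ?H n)"
    using Z_coset_exhausting one_closed by blast
  ultimately show ?thesis by simp
qed

lemma coset_from_one:
  assumes "g \<in> carrier (Z_group \<phi>)" "h \<in> carrier (Z_group \<phi>)"
  shows "Z_coset \<phi> (m n) (inv\<^bsub>Z_group \<phi>\<^esub> g \<otimes>\<^bsub>Z_group \<phi>\<^esub> h) = Z_coset \<phi> (m n) \<one>\<^bsub>Z_group \<phi>\<^esub>
    \<longleftrightarrow> Z_coset \<phi> (m n) g = Z_coset \<phi> (m n) h"
proof -
  interpret group "Z_group \<phi>" by (rule group_Z_group)
  show ?thesis
    using Z_coset_left_mult_iff[of g \<phi> h "inv\<^bsub>Z_group \<phi>\<^esub> g" "m n"] assms by (auto simp: eq_commute)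
qed

context
  fixes \<rho>
  assumes \<rho>: "proper_left_invariant_metric (Z_group \<phi>) \<rho>"
begin

lemma dist_from_one:
  assumes "g \<in> carrier (Z_group \<phi>)" "h \<in> carrier (Z_group \<phi>)"
  shows "mdist \<rho> \<one>\<^bsub>Z_group \<phi>\<^esub> (inv\<^bsub>Z_group \<phi>\<^esub> g \<otimes>\<^bsub>Z_group \<phi>\<^esub> h) = mdist \<rho> g h"
proof -
  interpret group "Z_group \<phi>" by (rule group_Z_group)
  have "mdist \<rho> (inv\<^bsub>Z_group \<phi>\<^esub> g \<otimes>\<^bsub>Z_group \<phi>\<^esub> g) (inv\<^bsub>Z_group \<phi>\<^esub> g \<otimes>\<^bsub>Z_group \<phi>\<^esub> h) = mdist \<rho> g h"
    using \<rho> assms inv_closed unfolding proper_left_invariant_metric_def by blast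
  then show ?thesis using assms by simp
qed

text \<open>By left invariance the diameters of all cosets are bounded by that of one finite set.\<close>

lemma Z_coset_bounded:
  "\<exists>L. \<forall>g\<in>carrier (Z_group \<phi>). \<forall>h\<in>carrier (Z_group \<phi>).
     Z_coset \<phi> (m n) g = Z_coset \<phi> (m n) h \<longrightarrow> mdist \<rho> g h \<le> L"
proof -
  interpret group "Z_group \<phi>" by (rule group_Z_group)
  define H where "H = {b \<in> carrier (Z_group \<phi>). Z_coset \<phi> (m n) b = Z_coset \<phi> (m n) \<one>\<^bsub>Z_group \<phi>\<^esub>}"
  have fin: "finite H"
    using card_Z_coset[OF one_closed, of n] m_pos[of n] by (simp add: H_def card_ge_0_finite)
  have "mdist \<rho> g h \<le> Max (mdist \<rho> \<one>\<^bsub>Z_group \<phi>\<^esub> ` H)"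
    if "g \<in> carrier (Z_group \<phi>)" "h \<in> carrier (Z_group \<phi>)" "Z_coset \<phi> (m n) g = Z_coset \<phi> (m n) h" for g h
  proof -
    have "inv\<^bsub>Z_group \<phi>\<^esub> g \<otimes>\<^bsub>Z_group \<phi>\<^esub> h \<in> H"
      using that coset_from_one[OF that(1,2)] by (simp add: H_def)
    then show ?thesis unfolding dist_from_one[OF that(1,2), symmetric] using fin by (intro Max_ge) auto
  qed
  then show ?thesis by blast
qed

text \<open>Conversely, the finitely many elements of a ball around the identity lie in one of the finite
  subgroups.\<close>

lemma ball_in_Z_coset:
  "\<exists>n. \<forall>g\<in>carrier (Z_group \<phi>). \<forall>h\<in>carrier (Z_group \<phi>).
     mdist \<rho> g h \<le> R \<longrightarrow> Z_coset \<phi> (m n) g = Z_coset \<phi> (m n) h"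
proof -
  interpret group "Z_group \<phi>" by (rule group_Z_group)
  define S where "S = {b \<in> carrier (Z_group \<phi>). mdist \<rho> \<one>\<^bsub>Z_group \<phi>\<^esub> b \<le> R}"
  have fin: "finite S"
    unfolding S_def by (intro proper_left_invariant_finite_ball is_group countable_Z_group \<rho> one_closed)
  have "\<forall>b\<in>S. \<exists>n. Z_coset \<phi> (m n) b = Z_coset \<phi> (m n) \<one>\<^bsub>Z_group \<phi>\<^esub>"
    using Z_coset_exhausting one_closed by (auto simp: S_def)
  then obtain N where N: "\<And>b. b \<in> S \<Longrightarrow> Z_coset \<phi> (m (N b)) b = Z_coset \<phi> (m (N b)) \<one>\<^bsub>Z_group \<phi>\<^esub>"
    by metis
  define n where "n = Max (insert 0 (N ` S))"
  have n: "Z_coset \<phi> (m n) b = Z_coset \<phi> (m n) \<one>\<^bsub>Z_group \<phi>\<^esub>" if "b \<in> S" for b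
    using fin that by (intro Z_coset_mono[OF _ N[OF that]]) (auto simp: n_def intro: Max_ge)
  have "Z_coset \<phi> (m n) g = Z_coset \<phi> (m n) h"
    if "g \<in> carrier (Z_group \<phi>)" "h \<in> carrier (Z_group \<phi>)" "mdist \<rho> g h \<le> R" for g h
    using n[of "inv\<^bsub>Z_group \<phi>\<^esub> g \<otimes>\<^bsub>Z_group \<phi>\<^esub> h"] coset_from_one[OF that(1,2)] dist_from_one[OF that(1,2)] that
    by (simp add: S_def)
  then show ?thesis by blast
qed

end

end


section \<open>The coarse decomposition\<close>

lemma coarse_mapI:
  assumes "\<And>x. x \<in> mspace X \<Longrightarrow> f x \<in> mspace Y"
    and "\<And>\<delta>. 0 \<le> \<delta> \<Longrightarrow> \<exists>L. \<forall>x\<in>mspace X. \<forall>x'\<in>mspace X. mdist X x x' \<le> \<delta> \<longrightarrow> mdist Y (f x) (f x') \<le> L"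
  shows "coarse_map X Y f"
  unfolding coarse_map_def
proof (intro conjI allI impI)
  show "f \<in> mspace X \<rightarrow> mspace Y" using assms(1) by auto
  fix \<delta> :: real assume "0 \<le> \<delta>"
  then obtain L where L: "\<forall>x\<in>mspace X. \<forall>x'\<in>mspace X. mdist X x x' \<le> \<delta> \<longrightarrow> mdist Y (f x) (f x') \<le> L"
    using assms(2) by blast
  then have "oscillation X Y f \<delta> \<le> ereal L"
    unfolding oscillation_def by (intro Sup_least) auto
  then show "oscillation X Y f \<delta> < \<infinity>" by (rule order_le_less_trans) simp
qed

lemma coarse_isomorphismI:
  assumes bij: "bij_betw f (mspace X) (mspace Y)"
    and f: "\<And>\<delta>. 0 \<le> \<delta> \<Longrightarrow> \<exists>L. \<forall>x\<in>mspace X. \<forall>x'\<in>mspace X. mdist X x x' \<le> \<delta> \<longrightarrow> mdist Y (f x) (f x') \<le> L"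
    and f': "\<And>\<delta>. 0 \<le> \<delta> \<Longrightarrow> \<exists>L. \<forall>x\<in>mspace X. \<forall>x'\<in>mspace X. mdist Y (f x) (f x') \<le> \<delta> \<longrightarrow> mdist X x x' \<le> L"
  shows "coarse_isomorphism X Y f"
  unfolding coarse_isomorphism_def
proof (intro conjI bij)
  show "coarse_map X Y f" using bij f by (intro coarse_mapI) (auto dest: bij_betwE)
  let ?g = "inv_into (mspace X) f"
  have g: "?g y \<in> mspace X" "f (?g y) = y" if "y \<in> mspace Y" for y
    using bij_betwE[OF bij_betw_inv_into[OF bij]] bij_betw_inv_into_right[OF bij] that by auto
  show "coarse_map Y X ?g"
  proof (rule coarse_mapI)
    show "?g y \<in> mspace X" if "y \<in> mspace Y" for y using g(1)[OF that] .
    fix \<delta> :: real assume "0 \<le> \<delta>"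
    then obtain L where "\<forall>x\<in>mspace X. \<forall>x'\<in>mspace X. mdist Y (f x) (f x') \<le> \<delta> \<longrightarrow> mdist X x x' \<le> L"
      using f' by blast
    then have "\<forall>y\<in>mspace Y. \<forall>y'\<in>mspace Y. mdist Y y y' \<le> \<delta> \<longrightarrow> mdist X (?g y) (?g y') \<le> L"
      using g by metis
    then show "\<exists>L. \<forall>y\<in>mspace Y. \<forall>y'\<in>mspace Y. mdist Y y y' \<le> \<delta> \<longrightarrow> mdist X (?g y) (?g y') \<le> L"
      by blast
  qed
qed

context bf_shift_homogeneous
begin

lemma tower_components: "tower (mspace X) K (component_count X x\<^sub>0)"
proof
  show "mspace X \<noteq> {}" using x0 by blast
  show "K (Suc n) a = K (Suc n) b" if "a \<in> mspace X" "b \<in> mspace X" "K n a = K n b" for n a b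
    using K_mono[of n "Suc n" a b] that by simp
  show "card (K 0 ` {b \<in> mspace X. K n b = K n a}) = component_count X x\<^sub>0 n" if a: "a \<in> mspace X" for n a
  proof -
    have "{b \<in> mspace X. K n b = K n a} = K n a"
      using K_in K_eq K_self by blast
    then show ?thesis
      using card_components_homogeneous[OF hom a x0] by (simp add: component_count_def K_0) (simp add: K_def)
  qed
qed (use K_exhausting component_count_pos[OF bf hom x0] in auto)

lemma Z_tower_components: "Z_tower (factorizing_function X) (component_count X x\<^sub>0)"
proof
  show "0 < component_count X x\<^sub>0 n" for n by (rule component_count_pos[OF bf hom x0])
  show "component_count X x\<^sub>0 0 = 1" by (rule component_count_0[OF x0])
  show "component_count X x\<^sub>0 n dvd component_count X x\<^sub>0 n'" if "n \<le> n'" for n n'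
    by (rule component_count_dvd[OF bf hom x0 that])
  show "enat (multiplicity p (component_count X x\<^sub>0 n)) \<le> factorizing_function X p" for p n
    by (rule multiplicity_component_count_le[OF x0])
  show "\<exists>n. j < multiplicity p (component_count X x\<^sub>0 n)"
    if "prime p" "enat j < factorizing_function X p" for p j
    by (rule less_factorizing_functionD[OF bf hom x0 that])
qed

end

theorem theorem1p4:
  fixes X :: "'a metric" and \<rho> :: "(nat \<Rightarrow> nat \<Rightarrow> int) metric" and x :: 'a
  assumes "mspace X \<noteq> {}"
    and "boundedly_finite X"
    and "shift_homogeneous X"
    and "x \<in> mspace X"
    and "proper_left_invariant_metric (Z_group (factorizing_function X)) \<rho>"
  shows "coarsely_isomorphic X
           (max_prod_metric (submetric X (scale_component X (factorizing_step X) x)) \<rho>)"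
proof -
  interpret bf_shift_homogeneous X x by unfold_locales (rule assms)+
  let ?\<phi> = "factorizing_function X"
  let ?m = "component_count X x"
  interpret Z: Z_tower ?\<phi> ?m by (rule Z_tower_components)
  let ?G = "carrier (Z_group ?\<phi>)"
  let ?d = "\<lambda>n. Z_coset ?\<phi> (?m n)"
  let ?Y = "max_prod_metric (submetric X (scale_component X (factorizing_step X) x)) \<rho>"
  have space: "mspace ?Y = K 0 x \<times> ?G"
    using assms(5) scale_component_subset[of X "factorizing_step X" x]
    by (auto simp: proper_left_invariant_metric_def K_0)
  have inj_d: "inj_on (?d 0) ?G"
    using inj_on_Z_coset_1 by (simp add: Z.m_0)
  obtain \<theta> where \<theta>: "\<theta> ` mspace X = ?G"
    "\<And>n a b. a \<in> mspace X \<Longrightarrow> b \<in> mspace X \<Longrightarrow> ?d n (\<theta> a) = ?d n (\<theta> b) \<longleftrightarrow> K n a = K n b"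
    using tower_map_exists[OF tower_components Z.tower_Z_group inj_d] by blast
  have \<theta>_eq: "\<theta> a = \<theta> b \<longleftrightarrow> K 0 a = K 0 b" if "a \<in> mspace X" "b \<in> mspace X" for a b
    using \<theta>(2)[OF that, of 0] inj_onD[OF inj_d, of "\<theta> a" "\<theta> b"] \<theta>(1) that by auto
  have \<theta>_in: "\<theta> a \<in> ?G" if "a \<in> mspace X" for a
    using \<theta>(1) that by blast
  define F where "F y = (core y, \<theta> y)" for y
  have dist: "mdist ?Y (F y) (F y') = max (mdist X (core y) (core y')) (mdist \<rho> (\<theta> y) (\<theta> y'))" for y y'
    by (simp add: F_def)
  have "bij_betw F (mspace X) (mspace ?Y)"
    unfolding space bij_betw_def
  proof (intro conjI)
    show "inj_on F (mspace X)"
      using \<theta>_eq core_inj_on_component by (auto simp: F_def inj_on_def)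
    show "F ` mspace X = K 0 x \<times> ?G"
    proof
      show "F ` mspace X \<subseteq> K 0 x \<times> ?G" using core_mem \<theta>(1) by (auto simp: F_def)
      show "K 0 x \<times> ?G \<subseteq> F ` mspace X"
      proof clarify
        fix w g assume "w \<in> K 0 x" "g \<in> ?G"
        then have "g \<in> \<theta> ` mspace X" by (simp add: \<theta>(1))
        then obtain a where a: "a \<in> mspace X" "\<theta> a = g" by blast
        obtain y where "y \<in> mspace X" "K 0 y = K 0 a" "core y = w"
          using core_surj_on_component[OF a(1) \<open>w \<in> K 0 x\<close>] by blast
        with a show "(w, g) \<in> F ` mspace X" using \<theta>_eq[of y a] by (auto simp: F_def)
      qed
    qed
  qed
  then have "coarse_isomorphism X ?Y F"
  proof (rule coarse_isomorphismI)
    fix \<delta> :: real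
    obtain n :: nat where n: "\<delta> \<le> real n" using real_arch_simple by blast
    obtain L where L: "\<And>y y'. y \<in> mspace X \<Longrightarrow> y' \<in> mspace X \<Longrightarrow> K n y = K n y' \<Longrightarrow>
        \<bar>mdist X (core y) (core y') - mdist X y y'\<bar> \<le> L"
      using core_almost_isometry[of n] by blast
    obtain M where M: "\<And>g h. g \<in> ?G \<Longrightarrow> h \<in> ?G \<Longrightarrow> ?d n g = ?d n h \<Longrightarrow> mdist \<rho> g h \<le> M"
      using Z.Z_coset_bounded[OF assms(5), of n] by blast
    have "mdist ?Y (F y) (F y') \<le> max (\<delta> + L) M"
      if y: "y \<in> mspace X" "y' \<in> mspace X" "mdist X y y' \<le> \<delta>" for y y'
    proof -
      have K: "K n y = K n y'" using y n by (intro K_close) auto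
      then have "mdist \<rho> (\<theta> y) (\<theta> y') \<le> M" using M[OF \<theta>_in[OF y(1)] \<theta>_in[OF y(2)]] \<theta>(2)[OF y(1,2)] by simp
      then show ?thesis unfolding dist using L[OF y(1,2) K] y(3) by linarith
    qed
    then show "\<exists>L. \<forall>y\<in>mspace X. \<forall>y'\<in>mspace X. mdist X y y' \<le> \<delta> \<longrightarrow> mdist ?Y (F y) (F y') \<le> L"
      by blast
  next
    fix \<delta> :: real
    obtain n where n: "\<And>g h. g \<in> ?G \<Longrightarrow> h \<in> ?G \<Longrightarrow> mdist \<rho> g h \<le> \<delta> \<Longrightarrow> ?d n g = ?d n h"
      using Z.ball_in_Z_coset[OF assms(5), of \<delta>] by blast
    obtain L where L: "\<And>y y'. y \<in> mspace X \<Longrightarrow> y' \<in> mspace X \<Longrightarrow> K n y = K n y' \<Longrightarrow>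
        \<bar>mdist X (core y) (core y') - mdist X y y'\<bar> \<le> L"
      using core_almost_isometry[of n] by blast
    have "mdist X y y' \<le> \<delta> + L"
      if y: "y \<in> mspace X" "y' \<in> mspace X" "mdist ?Y (F y) (F y') \<le> \<delta>" for y y'
    proof -
      have le: "mdist X (core y) (core y') \<le> \<delta>" "mdist \<rho> (\<theta> y) (\<theta> y') \<le> \<delta>"
        using y(3) unfolding dist by simp_all
      have "K n y = K n y'" using n[OF \<theta>_in[OF y(1)] \<theta>_in[OF y(2)] le(2)] \<theta>(2)[OF y(1,2)] by simp
      then show ?thesis using L[OF y(1,2)] le(1) by linarith
    qed
    then show "\<exists>L. \<forall>y\<in>mspace X. \<forall>y'\<in>mspace X. mdist ?Y (F y) (F y') \<le> \<delta> \<longrightarrow> mdist X y y' \<le> L"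
      by blast
  qed
  then show ?thesis unfolding coarsely_isomorphic_def by blast
qed

end
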